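(* Let $(\Omega,\mathcal{A},\mu)$ be a positive, $\sigma$-finite, complete measure space with $\Omega\subset\mathbb{R}^n$, let $d\in\mathbb{N}$, and let $\rho$ be a seminorm function on $\Omega$. Let $1\leq p_0\leq q_0\leq\infty$, $1\leq p_1\leq q_1\leq\infty$, $q_0\neq q_1$. Let $T$ be an operator, defined on the space $L^{p_0}_{\mathcal{K}}(\Omega,\rho)+L^{p_1}_{\mathcal{K}}(\Omega,\rho)$ and taking values in measurable functions $\Omega\to\mathcal{K}_{bcs}(\mathbb{R}^d)$, that is sublinear: for all $F,G\in L^{p_0}_{\mathcal{K}}(\Omega,\rho)+L^{p_1}_{\mathcal{K}}(\Omega,\rho)$, $\lambda\in\mathbb{R}$ and $x\in\Omega$, $$T(F+G)(x)\subset TF(x)+TG(x),\qquad T(\lambda F)(x)=\lambda\, TF(x).$$ Suppose that there exist two positive constants $C_0$ and $C_1$ such that $$\lVert T(F)\rVert_{L^{q_0,\infty}_{\mathcal{K}}(\Omega,\rho)}\leq C_0\lVert F\rVert_{L^{p_0}_{\mathcal{K}}(\Omega,\rho)}\quad\text{for all }F\in L^{p_0}_{\mathcal{K}}(\Omega,\rho),$$ $$\lVert T(F)\rVert_{L^{q_1,\infty}_{\mathcal{K}}(\Omega,\rho)}\leq C_1\lVert F\rVert_{L^{p_1}_{\mathcal{K}}(\Omega,\rho)}\quad\text{for all }F\in L^{p_1}_{\mathcal{K}}(\Omega,\rho).$$ Then for all $0<t<1$ and all $F\in L^{p}_{\mathcal{K}}(\Omega,\rho)$, $$\lVert T(F)\rVert_{L^{q}_{\mathcal{K}}(\Omega,\rho)}\leq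 C_t\lVert F\rVert_{L^{p}_{\mathcal{K}}(\Omega,\rho)},$$ where $$\frac{1}{p}=\frac{1-t}{p_0}+\frac{t}{p_1},\qquad \frac{1}{q}=\frac{1-t}{q_0}+\frac{t}{q_1},\qquad C_t=2\left(\frac{q}{|q-q_0|}+\frac{q}{|q-q_1|}\right)^{\frac{1}{q}}C_0^{1-t}C_1^{t}.$$
   Context: $\mathcal{K}_{bcs}(\mathbb{R}^d)$ is the collection of all nonempty, closed, bounded, convex, symmetric ($-E=E$) subsets of $\mathbb{R}^d$. For sets, $E+F=\{x+y:x\in E,y\in F\}$ and $\lambda E=\{\lambda x:x\in E\}$; sums and scalar multiples of set-valued functions are taken pointwise, and $L^{p_0}_{\mathcal{K}}+L^{p_1}_{\mathcal{K}}$ is the set of all pointwise sums $F_0+F_1$ with $F_i\in L^{p_i}_{\mathcal{K}}$. A function $F:\Omega\to\mathcal{K}_{bcs}(\mathbb{R}^d)$ is measurable if $\{x\in\Omega:F(x)\cap U\neq\emptyset\}\in\mathcal{A}$ for every open $U\subset\mathbb{R}^d$. A seminorm function on $\Omega$ is a map $\rho:\Omega\times\mathbb{R}^d\to[0,\infty)$ such that $\rho_x(\cdot)=\rho(x,\cdot)$ is a seminorm on $\mathbb{R}^d$ for all $x\in\Omega$, and $x\mapsto\rho_x(v)$ is measurable for every $v\in\mathbb{R}^d$. For $E\subset\mathbb{R}^d$, $\rho_x(E)=\sup_{v\in E}\rho_x(v)$. For $0<p<\infty$, $L^p_{\mathcal{K}}(\Omega,\rho)$ is the set of measurable $F:\Omega\to\mathcal{K}_{bcs}(\mathbb{R}^d)$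 with $\lVert F\rVert_{L^p_{\mathcal{K}}(\Omega,\rho)}=\left(\int_\Omega\rho_x(F(x))^p\,d\mu(x)\right)^{1/p}<\infty$, and $L^{p,\infty}_{\mathcal{K}}(\Omega,\rho)$ is the set of those with $\lVert F\rVert_{L^{p,\infty}_{\mathcal{K}}(\Omega,\rho)}=\sup_{\lambda>0}\lambda\,\mu(\{x\in\Omega:\rho_x(F(x))>\lambda\})^{1/p}<\infty$. For $p=\infty$, $\lVert F\rVert_{L^\infty_{\mathcal{K}}(\Omega,\rho)}=\operatorname{ess\,sup}_{x\in\Omega}\rho_x(F(x))$, and $L^{\infty,\infty}_{\mathcal{K}}=L^\infty_{\mathcal{K}}$ with the same norm. Conventions: $1/\infty=0$, and $q/|q-q_i|=0$ if $q_i=\infty$. *)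

theory Defs
  imports "HOL-Analysis.Analysis" "HOL-Probability.Essential_Supremum"
begin

definition Kbcs :: "(real ^ 'd) set set" where
  "Kbcs = {E. E \<noteq> {} \<and> closed E \<and> bounded E \<and> convex E \<and> uminus ` E = E}"

text \<open>Functions on \<open>\<Omega> = space M\<close> are represented as extensional functions, so that
  equality of functions in HOL is equality on \<open>\<Omega>\<close>.\<close>

definition measurable_Kbcs :: "'a measure \<Rightarrow> ('a \<Rightarrow> (real ^ 'd) set) set" where
  "measurable_Kbcs M = {F \<in> space M \<rightarrow>\<^sub>E Kbcs.
     \<forall>U. open U \<longrightarrow> {x \<in> space M. F x \<inter> U \<noteq> {}} \<in> sets M}"

definition setfun_plus ::
  "'a measure \<Rightarrow> ('a \<Rightarrow> (real ^ 'd) set) \<Rightarrow> ('a \<Rightarrow> (real ^ 'd) set) \<Rightarrow> 'a \<Rightarrow> (real ^ 'd) set" where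
  "setfun_plus M F G = (\<lambda>x\<in>space M. F x + G x)"

definition setfun_scale ::
  "'a measure \<Rightarrow> real \<Rightarrow> ('a \<Rightarrow> (real ^ 'd) set) \<Rightarrow> 'a \<Rightarrow> (real ^ 'd) set" where
  "setfun_scale M c F = (\<lambda>x\<in>space M. (*\<^sub>R) c ` F x)"

definition seminorm_on_space :: "(real ^ 'd \<Rightarrow> real) \<Rightarrow> bool" where
  "seminorm_on_space s \<longleftrightarrow>
     (\<forall>v. 0 \<le> s v) \<and> (\<forall>c v. s (c *\<^sub>R v) = \<bar>c\<bar> * s v) \<and> (\<forall>v w. s (v + w) \<le> s v + s w)"

definition seminorm_function :: "'a measure \<Rightarrow> ('a \<Rightarrow> real ^ 'd \<Rightarrow> real) \<Rightarrow> bool" where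
  "seminorm_function M \<rho> \<longleftrightarrow>
     (\<forall>x\<in>space M. seminorm_on_space (\<rho> x)) \<and> (\<forall>v. (\<lambda>x. \<rho> x v) \<in> borel_measurable M)"

definition rho_set :: "('a \<Rightarrow> real ^ 'd \<Rightarrow> real) \<Rightarrow> 'a \<Rightarrow> (real ^ 'd) set \<Rightarrow> ennreal" where
  "rho_set \<rho> x E = (SUP v\<in>E. ennreal (\<rho> x v))"

text \<open>Real powers on \<open>[0,\<infinity>]\<close>, only used for exponents \<open>r > 0\<close>.\<close>

definition ennpowr :: "ennreal \<Rightarrow> real \<Rightarrow> ennreal" where
  "ennpowr a r = (if a = top then top else ennreal (enn2real a powr r))"

text \<open>Exponents live in \<open>(0,\<infinity>]\<close>, represented in \<^typ>\<open>ennreal\<close>.\<close>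

definition Lp_norm ::
  "'a measure \<Rightarrow> ('a \<Rightarrow> real ^ 'd \<Rightarrow> real) \<Rightarrow> ennreal \<Rightarrow> ('a \<Rightarrow> (real ^ 'd) set) \<Rightarrow> ennreal" where
  "Lp_norm M \<rho> p F =
     (if p = top then esssup M (\<lambda>x. rho_set \<rho> x (F x))
      else ennpowr (\<integral>\<^sup>+ x. ennpowr (rho_set \<rho> x (F x)) (enn2real p) \<partial>M) (1 / enn2real p))"

definition weak_Lp_norm ::
  "'a measure \<Rightarrow> ('a \<Rightarrow> real ^ 'd \<Rightarrow> real) \<Rightarrow> ennreal \<Rightarrow> ('a \<Rightarrow> (real ^ 'd) set) \<Rightarrow> ennreal" where
  "weak_Lp_norm M \<rho> p F =
     (if p = top then Lp_norm M \<rho> top F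
      else (SUP l\<in>{0::real<..}.
        ennreal l * ennpowr (emeasure M {x \<in> space M. rho_set \<rho> x (F x) > ennreal l}) (1 / enn2real p)))"

definition Lp_space ::
  "'a measure \<Rightarrow> ('a \<Rightarrow> real ^ 'd \<Rightarrow> real) \<Rightarrow> ennreal \<Rightarrow> ('a \<Rightarrow> (real ^ 'd) set) set" where
  "Lp_space M \<rho> p = {F \<in> measurable_Kbcs M. Lp_norm M \<rho> p F < top}"

definition Lp_sum_space ::
  "'a measure \<Rightarrow> ('a \<Rightarrow> real ^ 'd \<Rightarrow> real) \<Rightarrow> ennreal \<Rightarrow> ennreal \<Rightarrow> ('a \<Rightarrow> (real ^ 'd) set) set" where
  "Lp_sum_space M \<rho> p0 p1 =
     {setfun_plus M F0 F1 | F0 F1. F0 \<in> Lp_space M \<rho> p0 \<and> F1 \<in> Lp_space M \<rho> p1}"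

definition sublinear_setop ::
  "'a measure \<Rightarrow> ('a \<Rightarrow> (real ^ 'd) set) set \<Rightarrow>
     (('a \<Rightarrow> (real ^ 'd) set) \<Rightarrow> 'a \<Rightarrow> (real ^ 'd) set) \<Rightarrow> bool" where
  "sublinear_setop M D T \<longleftrightarrow>
     T \<in> D \<rightarrow> measurable_Kbcs M \<and>
     (\<forall>F\<in>D. \<forall>G\<in>D. \<forall>x\<in>space M. T (setfun_plus M F G) x \<subseteq> T F x + T G x) \<and>
     (\<forall>F\<in>D. \<forall>c. \<forall>x\<in>space M. T (setfun_scale M c F) x = (*\<^sub>R) c ` T F x)"

text \<open>The quotient \<open>q / |q - q'|\<close> for \<open>q < \<infinity>\<close>, with the convention that it is \<open>0\<close> if
  \<open>q' = \<infinity>\<close>.\<close>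

definition exponent_ratio :: "ennreal \<Rightarrow> ennreal \<Rightarrow> real" where
  "exponent_ratio q q' =
     (if q' = top then 0 else enn2real q / \<bar>enn2real q - enn2real q'\<bar>)"

definition interp_const ::
  "ennreal \<Rightarrow> ennreal \<Rightarrow> ennreal \<Rightarrow> real \<Rightarrow> real \<Rightarrow> real \<Rightarrow> real" where
  "interp_const q0 q1 q t C0 C1 =
     2 * (exponent_ratio q q0 + exponent_ratio q q1) powr (1 / enn2real q)
       * C0 powr (1 - t) * C1 powr t"

end

theory Submission
  imports Defs
begin

text \<open>Write \<open>f = \<rho>(F)\<close>, \<open>g = \<rho>(T F)\<close>, and assume \<open>q\<^sub>0 < q\<^sub>1\<close>. At level \<open>l\<close> split \<open>F\<close> into its restrictions
  (extended by \<open>{0}\<close>) to \<open>{c f\<^sup>k > l}\<close> and \<open>{c f\<^sup>k \<le> l}\<close>, where \<open>k\<close> is determined by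
  \<open>p/p\<^sub>i - 1 = k (q/q\<^sub>i - 1)\<close> for \<open>i = 0, 1\<close>. The exponent \<open>k\<close> may be negative, and it is \<open>0\<close> if
  \<open>p\<^sub>0 = p\<^sub>1\<close>, so these cases need no separate treatment. Sublinearity and the weak-type bounds estimate
  \<open>\<mu>{g > 2 l}\<close>, and integration against \<open>l\<^sup>q\<^sup>-\<^sup>1 dl\<close> bounds the \<open>L\<^sup>q\<close> norm. The constant \<open>c\<close> is chosen so
  that both pieces contribute the same multiple of \<open>1/|q - q\<^sub>i|\<close>; if \<open>q\<^sub>1 = \<infinity>\<close> it is chosen so that
  \<open>T\<close> of the second piece is bounded by \<open>l\<close> almost everywhere.\<close>

section \<open>Integrals over level truncations\<close>

lemma nn_integral_powr_below:
  assumes "0 < a" "0 \<le> b"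
  shows "(\<integral>\<^sup>+ l. ennreal (l powr (a - 1)) * indicator {0<..<b} l \<partial>lborel) = ennreal (b powr a / a)"
proof -
  have "((\<lambda>l. l powr (a - 1)) has_integral (b powr a / a)) {0..b}"
    using has_integral_powr_from_0[of "a - 1" b] assms by simp
  then have "(\<integral>\<^sup>+ l. ennreal (l powr (a - 1)) * indicator {0..b} l \<partial>lborel) = ennreal (b powr a / a)"
    by (intro nn_integral_has_integral_lebesgue') auto
  \<comment> \<open>The layer-cake formula has strict inequalities, hence the open interval; its
    endpoints form a null set.\<close>
  moreover have "(\<integral>\<^sup>+ l. ennreal (l powr (a - 1)) * indicator {0<..<b} l \<partial>lborel)
      = (\<integral>\<^sup>+ l. ennreal (l powr (a - 1)) * indicator {0..b} l \<partial>lborel)"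
    using AE_lborel_singleton[of "0::real"] AE_lborel_singleton[of b]
    by (intro nn_integral_cong_AE, eventually_elim) (auto simp: indicator_def)
  ultimately show ?thesis by simp
qed

lemma nn_integral_powr_above:
  assumes "a < 0" "0 < b"
  shows "(\<integral>\<^sup>+ l. ennreal (l powr (a - 1)) * indicator {b..} l \<partial>lborel) = ennreal (b powr a / - a)"
proof -
  have "((\<lambda>l. l powr (a - 1)) has_integral (b powr a / - a)) {b..}"
    using has_integral_powr_to_inf[of "a - 1" b] assms by simp
  then show ?thesis
    by (intro nn_integral_has_integral_lebesgue') auto
qed

section \<open>Jensen's inequality for powers\<close>

text \<open>The right side minus the left is the height of \<open>u powr r\<close> above its tangent
  at \<open>y\<close>, which convexity makes nonnegative; Young's inequality with the exponents
  \<open>r\<close> and \<open>r / (r - 1)\<close> yields it directly.\<close>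

lemma powr_tangent:
  fixes u y r :: real
  assumes "0 \<le> u" "0 < y" "1 \<le> r"
  shows "r * y powr (r - 1) * u \<le> u powr r + (r - 1) * y powr r"
proof (cases "u = 0 \<or> r = 1")
  case True
  then show ?thesis using assms by auto
next
  case False
  then have u: "u > 0" and r: "r > 1" using assms by auto
  have "u * y powr (r - 1) \<le> u powr r / r + (y powr (r - 1)) powr (r / (r - 1)) / (r / (r - 1))"
    using u r assms by (intro Youngs_inequality) (auto simp: field_simps)
  also have "(y powr (r - 1)) powr (r / (r - 1)) = y powr r"
    using r by (simp add: powr_powr)
  finally have "r * (u * y powr (r - 1)) \<le> r * (u powr r / r + y powr r / (r / (r - 1)))"
    using r by (intro mult_left_mono) auto
  moreover have "r * (u powr r / r + y powr r / (r / (r - 1))) = u powr r + (r - 1) * y powr r"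
    using r by (simp add: distrib_left)
  ultimately show ?thesis by (simp add: ac_simps)
qed

text \<open>Jensen's inequality for the measure with density \<open>w\<close> and mass
  \<open>N\<close>: the tangent inequality at the mean \<open>y = H / N\<close> is integrated
  against \<open>w\<close>.\<close>

lemma jensen_powr_nn_integral:
  fixes w u :: "'a \<Rightarrow> real"
  assumes [measurable]: "w \<in> borel_measurable M" "u \<in> borel_measurable M"
    and w0: "\<And>x. 0 \<le> w x" and u0: "\<And>x. 0 \<le> u x" and r: "1 \<le> r"
    and N: "(\<integral>\<^sup>+ x. ennreal (w x) \<partial>M) = ennreal N" "0 < N"
    and H: "(\<integral>\<^sup>+ x. ennreal (w x * u x) \<partial>M) = ennreal H" "0 \<le> H"
  shows "ennreal (H powr r) \<le> ennreal (N powr (r - 1)) * (\<integral>\<^sup>+ x. ennreal (w x * u x powr r) \<partial>M)"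
proof (cases "H = 0")
  case False
  then have H0: "H > 0" using H by simp
  define y where "y = H / N"
  have y: "y > 0" using H0 N by (simp add: y_def)
  let ?S = "\<integral>\<^sup>+ x. ennreal (w x * u x powr r) \<partial>M"
  \<comment> \<open>As \<open>H = y * N\<close>, the left side of the integrated inequality becomes
    \<open>r\<close> times a term that occurs \<open>r - 1\<close> times on the right.\<close>
  have yH: "y powr (r - 1) * H = y powr r * N"
    using y N by (simp add: y_def powr_diff field_simps)
  have "ennreal (r * y powr (r - 1)) * ennreal H
      = (\<integral>\<^sup>+ x. ennreal (w x * (r * y powr (r - 1) * u x)) \<partial>M)"
    using r u0 w0 unfolding H(1)[symmetric]
    by (subst nn_integral_cmult[symmetric])
       (auto intro!: nn_integral_cong simp: ennreal_mult[symmetric] ac_simps)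
  also have "\<dots> \<le> (\<integral>\<^sup>+ x. ennreal (w x * u x powr r) + ennreal ((r - 1) * y powr r) * ennreal (w x) \<partial>M)"
  proof (intro nn_integral_mono)
    fix x
    have "w x * (r * y powr (r - 1) * u x) \<le> w x * (u x powr r + (r - 1) * y powr r)"
      using powr_tangent[OF u0 y r] w0 by (intro mult_left_mono) auto
    also have "\<dots> = w x * u x powr r + (r - 1) * y powr r * w x"
      by (simp add: algebra_simps)
    finally have "ennreal (w x * (r * y powr (r - 1) * u x))
      \<le> ennreal (w x * u x powr r + (r - 1) * y powr r * w x)"
      by (rule ennreal_leI)
    then show "ennreal (w x * (r * y powr (r - 1) * u x))
      \<le> ennreal (w x * u x powr r) + ennreal ((r - 1) * y powr r) * ennreal (w x)"
      using w0 r by (simp add: ennreal_mult[symmetric])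
  qed
  also have "\<dots> = ?S + ennreal ((r - 1) * y powr r) * ennreal N"
    by (subst nn_integral_add) (auto simp: nn_integral_cmult N)
  finally have le: "ennreal (r * y powr (r - 1)) * ennreal H \<le> ?S + ennreal ((r - 1) * y powr r) * ennreal N" .
  \<comment> \<open>The cancellation takes place in the reals; if \<open>?S\<close> is infinite
    there is nothing to show.\<close>
  have main: "ennreal (y powr r * N) \<le> ?S"
  proof (cases ?S)
    case (real s)
    have "r * y powr (r - 1) * H \<le> s + (r - 1) * y powr r * N"
      using le real H0 N r unfolding real
      by (simp add: ennreal_mult[symmetric] ennreal_plus[symmetric] del: ennreal_plus)
    moreover have "r * y powr (r - 1) * H = r * (y powr r * N)" using yH by simp
    ultimately have "r * (y powr r * N) \<le> s + (r - 1) * y powr r * N" by linarith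
    then have "y powr r * N \<le> s" by (simp add: algebra_simps)
    then show ?thesis unfolding real(2) by (rule ennreal_leI)
  next
    case top then show ?thesis by simp
  qed
  have "H powr r = N powr (r - 1) * (y powr r * N)"
    using H0 N by (simp add: y_def powr_diff powr_divide)
  then have "ennreal (H powr r) = ennreal (N powr (r - 1)) * ennreal (y powr r * N)"
    using N by (simp add: ennreal_mult[symmetric])
  also have "\<dots> \<le> ennreal (N powr (r - 1)) * ?S"
    using main by (intro mult_left_mono) auto
  finally show ?thesis .
qed simp

section \<open>Layer-cake formula\<close>

text \<open>\<open>g x powr q\<close> is \<open>q\<close> times the integral of
  \<open>l powr (q - 1)\<close> over \<open>0 < l < g x\<close>; Tonelli's theorem exchanges the two
  integrals, which is where sigma-finiteness enters.\<close>

lemma (in sigma_finite_measure) nn_integral_powr_layer_cake: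
  fixes g :: "'a \<Rightarrow> real"
  assumes [measurable]: "g \<in> borel_measurable M" and g0: "\<And>x. 0 \<le> g x" and q: "0 < q"
  shows "(\<integral>\<^sup>+ x. ennreal (g x powr q) \<partial>M)
    = ennreal q * (\<integral>\<^sup>+ l. ennreal (l powr (q - 1)) * indicator {0<..} l * emeasure M {x \<in> space M. l < g x} \<partial>lborel)"
proof -
  interpret L: pair_sigma_finite M lborel ..
  have "(\<integral>\<^sup>+ l. ennreal (l powr (q - 1)) * indicator {0<..} l * emeasure M {x \<in> space M. l < g x} \<partial>lborel)
    = (\<integral>\<^sup>+ l. (\<integral>\<^sup>+ x. ennreal (l powr (q - 1)) * indicator {0<..} l * indicator {x \<in> space M. l < g x} x \<partial>M) \<partial>lborel)"
    by (intro nn_integral_cong) (subst nn_integral_cmult_indicator, auto)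
  also have "\<dots> = (\<integral>\<^sup>+ l. (\<integral>\<^sup>+ x. (if 0 < l \<and> l < g x then ennreal (l powr (q - 1)) else 0) \<partial>M) \<partial>lborel)"
    by (intro nn_integral_cong) (auto simp: indicator_def)
  also have "\<dots> = (\<integral>\<^sup>+ x. (\<integral>\<^sup>+ l. (if 0 < l \<and> l < g x then ennreal (l powr (q - 1)) else 0) \<partial>lborel) \<partial>M)"
    by (rule L.Fubini') measurable
  also have "\<dots> = (\<integral>\<^sup>+ x. (\<integral>\<^sup>+ l. ennreal (l powr (q - 1)) * indicator {0<..<g x} l \<partial>lborel) \<partial>M)"
    by (intro nn_integral_cong) (auto simp: indicator_def)
  also have "\<dots> = (\<integral>\<^sup>+ x. ennreal (1 / q) * ennreal (g x powr q) \<partial>M)"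
    using q g0 by (subst nn_integral_powr_below) (auto simp: ennreal_mult[symmetric])
  also have "\<dots> = ennreal (1 / q) * (\<integral>\<^sup>+ x. ennreal (g x powr q) \<partial>M)"
    by (rule nn_integral_cmult) measurable
  finally show ?thesis
    using q by (simp add: mult.assoc[symmetric] ennreal_mult[symmetric])
qed

text \<open>Index \<open>i\<close> keeps the part of \<open>F\<close> above the level if \<open>q\<^sub>i < q\<close> (flag \<open>True\<close>), and the part
  below it if \<open>q\<^sub>i > q\<close>.\<close>

definition level_sel :: "bool \<Rightarrow> real \<Rightarrow> real \<Rightarrow> bool" where
  "level_sel b l y \<longleftrightarrow> (if b then l < y else y \<le> l)"

text \<open>The selection keeps the levels where the power is integrable: those near 0 if
  \<open>s < q\<close>, those near infinity if \<open>q < s\<close>. The absolute value merges the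
  two cases.\<close>

lemma nn_integral_level_kernel:
  assumes "0 < y" "q \<noteq> s"
  shows "(\<integral>\<^sup>+ l. ennreal (l powr (q - s - 1)) * indicator {0<..} l * indicator {l. level_sel (s < q) l y} l \<partial>lborel)
    = ennreal (y powr (q - s) / \<bar>q - s\<bar>)"
proof (cases "s < q")
  case True
  have "(\<integral>\<^sup>+ l. ennreal (l powr (q - s - 1)) * indicator {0<..} l * indicator {l. level_sel (s < q) l y} l \<partial>lborel)
    = (\<integral>\<^sup>+ l. ennreal (l powr (q - s - 1)) * indicator {0<..<y} l \<partial>lborel)"
    using True by (intro nn_integral_cong) (auto simp: level_sel_def indicator_def)
  then show ?thesis using True assms by (simp add: nn_integral_powr_below)
next
  case False
  have "(\<integral>\<^sup>+ l. ennreal (l powr (q - s - 1)) * indicator {0<..} l * indicator {l. level_sel (s < q) l y} l \<partial>lborel)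
    = (\<integral>\<^sup>+ l. ennreal (l powr (q - s - 1)) * indicator {y..} l \<partial>lborel)"
    using False assms by (intro nn_integral_cong) (auto simp: level_sel_def indicator_def)
  then show ?thesis using False assms nn_integral_powr_above[of "q - s" y] by simp
qed


text \<open>By \<open>rel\<close>, for \<open>f > 0\<close> the left side is
  \<open>(f powr k) powr (- e * s) * f powr p\<close>. The selection bounds \<open>f powr k\<close>
  by \<open>l / c\<close> from below if \<open>e > 0\<close> and from above if \<open>e < 0\<close>,
  and in both cases the power \<open>- e * s\<close> turns this into an upper bound.\<close>

lemma level_truncated_powr_le:
  fixes f s p k e c l :: real
  assumes f: "0 \<le> f" and c: "0 < c" and l: "0 < l" and s: "0 < s" and e: "e \<noteq> 0"
    and rel: "p - s = k * e * s" and sel: "level_sel (0 < e) l (c * f powr k)"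
  shows "f powr s \<le> (l / c) powr (- e * s) * f powr p"
proof (cases "f = 0")
  case False
  then have f: "0 < f" using f by simp
  have "f powr s = (f powr k) powr (- e * s) * f powr p"
    using rel f by (simp add: powr_powr powr_add[symmetric] algebra_simps)
  also have "\<dots> \<le> (l / c) powr (- e * s) * f powr p"
  proof (intro mult_right_mono)
    show "(f powr k) powr (- e * s) \<le> (l / c) powr (- e * s)"
    proof (cases "0 < e")
      case True
      then have "l / c \<le> f powr k" using sel c by (simp add: level_sel_def field_simps)
      then show ?thesis using True s l c by (intro powr_mono2') auto
    next
      case False
      then have "f powr k \<le> l / c" using sel c by (simp add: level_sel_def field_simps)
      then show ?thesis using False s l c by (intro powr_mono2) (auto simp: mult_nonpos_nonneg)
    qed
  qed simp
  finally show ?thesis .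
qed simp

lemma measurable_level_sel [measurable]:
  assumes [measurable]: "u \<in> borel_measurable N" "v \<in> borel_measurable N"
  shows "Measurable.pred N (\<lambda>z. level_sel b (u z) (v z))"
  unfolding level_sel_def by (cases b) simp_all

text \<open>When \<open>f powr p\<close> is integrable, this puts the selected piece of
  \<open>F\<close> into the endpoint space of exponent \<open>s\<close>.\<close>

lemma nn_integral_level_truncated_le:
  fixes f :: "'a \<Rightarrow> real"
  assumes [measurable]: "f \<in> borel_measurable M" and f0: "\<And>x. 0 \<le> f x"
    and "0 < c" "0 < l" "0 < s" "e \<noteq> 0" "p - s = k * e * s"
  shows "(\<integral>\<^sup>+ x. ennreal (f x powr s) * indicator {x. level_sel (0 < e) l (c * f x powr k)} x \<partial>M)
    \<le> ennreal ((l / c) powr (- e * s)) * (\<integral>\<^sup>+ x. ennreal (f x powr p) \<partial>M)"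
proof -
  have "(\<integral>\<^sup>+ x. ennreal (f x powr s) * indicator {x. level_sel (0 < e) l (c * f x powr k)} x \<partial>M)
    \<le> (\<integral>\<^sup>+ x. ennreal ((l / c) powr (- e * s)) * ennreal (f x powr p) \<partial>M)"
    using level_truncated_powr_le[OF f0] assms
    by (intro nn_integral_mono) (auto simp: indicator_def ennreal_mult[symmetric] intro!: ennreal_leI)
  also have "\<dots> = ennreal ((l / c) powr (- e * s)) * (\<integral>\<^sup>+ x. ennreal (f x powr p) \<partial>M)"
    by (rule nn_integral_cmult) measurable
  finally show ?thesis .
qed

text \<open>Applying Jensen's inequality with respect to the measure \<open>f\<^sup>p d\<mu>\<close> at each fixed level, before
  integrating in the level, replaces Minkowski's integral inequality.\<close>

lemma (in sigma_finite_measure) nn_integral_level_truncations_le: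
  fixes f :: "'a \<Rightarrow> real"
  assumes [measurable]: "f \<in> borel_measurable M" and f0: "\<And>x. 0 \<le> f x"
    and c: "0 < c" and s: "0 < s" "s \<le> Q" and e: "e \<noteq> 0"
    and rel: "p - s = k * e * s" "q - Q = e * Q"
    and N: "(\<integral>\<^sup>+ x. ennreal (f x powr p) \<partial>M) = ennreal N" "0 < N"
  shows "(\<integral>\<^sup>+ l. ennreal (l powr (q - Q - 1)) * indicator {0<..} l *
      ennpowr (\<integral>\<^sup>+ x. ennreal (f x powr s) * indicator {x. level_sel (0 < e) l (c * f x powr k)} x \<partial>M) (Q / s)
      \<partial>lborel)
    \<le> ennreal (c powr (q - Q) * N powr (Q / s) / \<bar>q - Q\<bar>)"
proof -
  interpret L: pair_sigma_finite M lborel ..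
  define r where "r = Q / s"
  have r: "1 \<le> r" using s by (simp add: r_def)
  have Q: "0 < Q" using s by simp
  \<comment> \<open>\<open>e\<close> has the sign of \<open>q - Q\<close>, so the flag
    \<open>0 < e\<close> agrees with the flag \<open>Q < q\<close> of the level kernel.\<close>
  have pos: "Q < q \<longleftrightarrow> 0 < e" using rel(2) Q by (metis diff_gt_0_iff_gt zero_less_mult_pos2 mult_pos_pos)
  have neq: "q \<noteq> Q" using rel(2) e Q by auto
  define X :: "real \<Rightarrow> 'a \<Rightarrow> real" where "X l x = indicator {x. level_sel (0 < e) l (c * f x powr k)} x" for l x
  have X01: "X l x = 0 \<or> X l x = (1::real)" for l x by (auto simp: X_def indicator_def)
  have Xm[measurable]: "(\<lambda>z. X (fst z) (snd z) :: real) \<in> borel_measurable (lborel \<Otimes>\<^sub>M M)"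
    unfolding X_def indicator_def by measurable
  have Xm'[measurable]: "(\<lambda>x. X l x :: real) \<in> borel_measurable M" for l
    unfolding X_def indicator_def by measurable
  \<comment> \<open>\<open>f powr s\<close> is split as the weight \<open>f powr p\<close> times
    \<open>f powr (s - p)\<close>. Jensen's inequality raises the second factor to the power
    \<open>r\<close>, which gives \<open>W\<close>; the indicator \<open>X\<close> is unchanged by
    powers.\<close>
  define W where "W x = f x powr p * f x powr ((s - p) * r)" for x
  have Wm[measurable]: "W \<in> borel_measurable M" unfolding W_def by measurable
  have jen: "ennpowr (\<integral>\<^sup>+ x. ennreal (f x powr s) * indicator {x. level_sel (0 < e) l (c * f x powr k)} x \<partial>M) r
    \<le> ennreal (N powr (r - 1)) * (\<integral>\<^sup>+ x. ennreal (W x * X l x) \<partial>M)" (is "ennpowr ?H r \<le> _")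
    if l: "0 < l" for l
  proof -
    have "?H \<le> ennreal ((l / c) powr (- e * s)) * ennreal N"
      using nn_integral_level_truncated_le[of f M c l s e p k] assms l by simp
    also have "\<dots> < top" by (simp add: ennreal_mult_less_top)
    finally have Hlt: "?H < top" .
    then have H: "?H = ennreal (enn2real ?H)" by simp
    have "ennreal (enn2real ?H powr r)
      \<le> ennreal (N powr (r - 1)) * (\<integral>\<^sup>+ x. ennreal (f x powr p * (f x powr (s - p) * X l x) powr r) \<partial>M)"
    proof (rule jensen_powr_nn_integral)
      have "(\<integral>\<^sup>+ x. ennreal (f x powr p * (f x powr (s - p) * X l x)) \<partial>M) = ?H"
        by (intro nn_integral_cong)
           (auto simp: X_def indicator_def powr_add[symmetric])
      then show "(\<integral>\<^sup>+ x. ennreal (f x powr p * (f x powr (s - p) * X l x)) \<partial>M) = ennreal (enn2real ?H)"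
        using H by simp
      show "0 \<le> f x powr (s - p) * X l x" for x using X01[of l x] by auto
    qed (use N r in auto)
    also have "(\<lambda>x. f x powr p * (f x powr (s - p) * X l x) powr r) = (\<lambda>x. W x * X l x)"
      using X01[of l] r by (intro ext) (auto simp: W_def powr_mult powr_powr X_def indicator_def)
    finally show ?thesis using Hlt by (simp add: ennpowr_def less_top[symmetric])
  qed
  have "(\<integral>\<^sup>+ l. ennreal (l powr (q - Q - 1)) * indicator {0<..} l *
      ennpowr (\<integral>\<^sup>+ x. ennreal (f x powr s) * indicator {x. level_sel (0 < e) l (c * f x powr k)} x \<partial>M) (Q / s)
      \<partial>lborel)
    \<le> (\<integral>\<^sup>+ l. (\<integral>\<^sup>+ x. ennreal (l powr (q - Q - 1)) * indicator {0<..} l * (ennreal (N powr (r - 1)) *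
        ennreal (W x * X l x)) \<partial>M) \<partial>lborel)"
    using jen unfolding r_def[symmetric]
    by (intro nn_integral_mono) (auto simp: indicator_def nn_integral_cmult intro!: mult_left_mono)
  \<comment> \<open>With the level integral inside, each fixed \<open>x\<close> with
    \<open>f x > 0\<close> gives the level kernel with threshold
    \<open>c * f x powr k\<close>.\<close>
  also have "\<dots> = (\<integral>\<^sup>+ x. (\<integral>\<^sup>+ l. ennreal (l powr (q - Q - 1)) * indicator {0<..} l * (ennreal (N powr (r - 1)) *
        ennreal (W x * X l x)) \<partial>lborel) \<partial>M)"
    unfolding X_def indicator_def by (rule L.Fubini') measurable
  also have "\<dots> \<le> (\<integral>\<^sup>+ x. ennreal (N powr (r - 1) * c powr (q - Q) / \<bar>q - Q\<bar>) * ennreal (f x powr p) \<partial>M)"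
  proof (intro nn_integral_mono)
    fix x
    show "(\<integral>\<^sup>+ l. ennreal (l powr (q - Q - 1)) * indicator {0<..} l * (ennreal (N powr (r - 1)) *
        ennreal (W x * X l x)) \<partial>lborel) \<le> ennreal (N powr (r - 1) * c powr (q - Q) / \<bar>q - Q\<bar>) * ennreal (f x powr p)"
    proof (cases "f x = 0")
      case True
      then show ?thesis by (simp add: W_def)
    next
      case False
      then have fx: "0 < f x" using f0[of x] by simp
      have "(\<integral>\<^sup>+ l. ennreal (l powr (q - Q - 1)) * indicator {0<..} l * (ennreal (N powr (r - 1)) *
        ennreal (W x * X l x)) \<partial>lborel)
        = (\<integral>\<^sup>+ l. ennreal (N powr (r - 1) * W x) * (ennreal (l powr (q - Q - 1)) * indicator {0<..} l *
           indicator {l. level_sel (Q < q) l (c * f x powr k)} l) \<partial>lborel)"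
        by (intro nn_integral_cong) (auto simp: X_def indicator_def pos ennreal_mult W_def ac_simps)
      also have "\<dots> = ennreal (N powr (r - 1) * W x) * (\<integral>\<^sup>+ l. (ennreal (l powr (q - Q - 1)) * indicator {0<..} l *
           indicator {l. level_sel (Q < q) l (c * f x powr k)} l) \<partial>lborel)"
        unfolding indicator_def by (rule nn_integral_cmult) measurable
      also have "\<dots> = ennreal (N powr (r - 1) * W x) * ennreal ((c * f x powr k) powr (q - Q) / \<bar>q - Q\<bar>)"
        using fx c neq by (subst nn_integral_level_kernel) auto
      also have "\<dots> = ennreal (N powr (r - 1) * c powr (q - Q) / \<bar>q - Q\<bar> * f x powr p)"
      proof -
        \<comment> \<open>This is the purpose of \<open>k\<close>:
          \<open>s - p = - k * e * s\<close> and \<open>q - Q = e * Q\<close>, so all powers of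
          \<open>f\<close> cancel except the weight \<open>f powr p\<close>, whose integral is
          \<open>N\<close>.\<close>
        have "(s - p) * r + k * (q - Q) = 0"
          unfolding r_def rel(2) using rel(1) s by (simp add: field_simps)
        then have "f x powr ((s - p) * r) * (f x powr k) powr (q - Q) = 1"
          using fx by (simp add: powr_powr powr_add[symmetric])
        then have "W x * (c * f x powr k) powr (q - Q) = c powr (q - Q) * f x powr p"
          unfolding W_def using c fx by (simp add: powr_mult)
        then have "N powr (r - 1) * W x * ((c * f x powr k) powr (q - Q) / \<bar>q - Q\<bar>)
            = N powr (r - 1) * c powr (q - Q) / \<bar>q - Q\<bar> * f x powr p"
          by (simp add: mult.assoc)
        then show ?thesis using W_def by (simp add: ennreal_mult[symmetric])
      qed
      finally show ?thesis by (simp add: ennreal_mult[symmetric])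
    qed
  qed
  also have "\<dots> = ennreal (N powr (r - 1) * c powr (q - Q) / \<bar>q - Q\<bar>) * ennreal N"
    unfolding N(1)[symmetric] by (rule nn_integral_cmult) measurable
  also have "\<dots> = ennreal (c powr (q - Q) * N powr (Q / s) / \<bar>q - Q\<bar>)"
    using N(2) by (simp add: ennreal_mult[symmetric] r_def[symmetric] powr_diff ac_simps)
  finally show ?thesis .
qed

section \<open>Contribution of one piece\<close>

text \<open>The bound at level \<open>l\<close> that a weak-type estimate from exponent
  \<open>s\<close> to exponent \<open>Q\<close> with constant \<open>C\<close> gives for
  \<open>T\<close> of the selected piece: the \<open>Q\<close>-th power of \<open>C / l\<close>
  times its \<open>L^s\<close> norm. Below, \<open>h\<close> is \<open>c * f powr k\<close>.\<close>

definition level_term ::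
  "'a measure \<Rightarrow> ('a \<Rightarrow> real) \<Rightarrow> ('a \<Rightarrow> real) \<Rightarrow> bool \<Rightarrow> real \<Rightarrow> real \<Rightarrow> real \<Rightarrow> real \<Rightarrow> ennreal" where
  "level_term M f h b C Q s l = ennreal ((C / l) powr Q) *
     ennpowr (\<integral>\<^sup>+ x. ennreal (f x powr s) * indicator {x. level_sel b l (h x)} x \<partial>M) (Q / s)"

lemma measurable_ennpowr [measurable]:
  assumes [measurable]: "u \<in> borel_measurable N"
  shows "(\<lambda>x. ennpowr (u x) r) \<in> borel_measurable N"
  unfolding ennpowr_def by measurable

lemma (in sigma_finite_measure) measurable_level_term [measurable]:
  assumes [measurable]: "f \<in> borel_measurable M" "h \<in> borel_measurable M"
  shows "level_term M f h b C Q s \<in> borel_measurable borel"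
  unfolding level_term_def indicator_def by measurable

lemma (in sigma_finite_measure) nn_integral_level_term_le:
  fixes f :: "'a \<Rightarrow> real"
  assumes [measurable]: "f \<in> borel_measurable M" and f0: "\<And>x. 0 \<le> f x"
    and c: "0 < c" and s: "0 < s" "s \<le> Q" and e: "e \<noteq> 0" and C: "0 < C"
    and rel: "p - s = k * e * s" "q - Q = e * Q"
    and N: "(\<integral>\<^sup>+ x. ennreal (f x powr p) \<partial>M) = ennreal N" "0 < N"
  shows "(\<integral>\<^sup>+ l. ennreal (l powr (q - 1)) * indicator {0<..} l *
      level_term M f (\<lambda>x. c * f x powr k) (0 < e) C Q s l \<partial>lborel)
    \<le> ennreal (C powr Q * N powr (Q / s) * c powr (q - Q) / \<bar>q - Q\<bar>)"
proof -
  let ?E = "\<lambda>l. ennpowr (\<integral>\<^sup>+ x. ennreal (f x powr s) * indicator {x. level_sel (0 < e) l (c * f x powr k)} x \<partial>M) (Q / s)"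
  have "(\<integral>\<^sup>+ l. ennreal (l powr (q - 1)) * indicator {0<..} l *
      level_term M f (\<lambda>x. c * f x powr k) (0 < e) C Q s l \<partial>lborel)
    = (\<integral>\<^sup>+ l. ennreal (C powr Q) * (ennreal (l powr (q - Q - 1)) * indicator {0<..} l * ?E l) \<partial>lborel)"
  proof (intro nn_integral_cong)
    fix l :: real
    have "l powr (q - 1) * (C / l) powr Q = C powr Q * l powr (q - Q - 1)" if "0 < l"
      using that C by (simp add: powr_divide powr_diff ac_simps)
    then have "ennreal (l powr (q - 1)) * ennreal ((C / l) powr Q) = ennreal (C powr Q) * ennreal (l powr (q - Q - 1))" if "0 < l"
      using that by (simp add: ennreal_mult[symmetric])
    then show "ennreal (l powr (q - 1)) * indicator {0<..} l * level_term M f (\<lambda>x. c * f x powr k) (0 < e) C Q s l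
      = ennreal (C powr Q) * (ennreal (l powr (q - Q - 1)) * indicator {0<..} l * ?E l)"
      by (cases "0 < l") (simp_all add: level_term_def mult.assoc[symmetric])
  qed
  also have "\<dots> = ennreal (C powr Q) * (\<integral>\<^sup>+ l. ennreal (l powr (q - Q - 1)) * indicator {0<..} l * ?E l \<partial>lborel)"
    unfolding indicator_def by (rule nn_integral_cmult) measurable
  also have "\<dots> \<le> ennreal (C powr Q) * ennreal (c powr (q - Q) * N powr (Q / s) / \<bar>q - Q\<bar>)"
    by (intro mult_left_mono nn_integral_level_truncations_le[OF assms(1) f0 c s e rel N]) auto
  also have "\<dots> = ennreal (C powr Q * N powr (Q / s) * c powr (q - Q) / \<bar>q - Q\<bar>)"
    by (simp add: ennreal_mult[symmetric] ac_simps)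
  finally show ?thesis .
qed

text \<open>The split at level \<open>l\<close> controls the set where \<open>g > 2 * l\<close>, so
  the layer-cake formula is applied to \<open>g / 2\<close>; this produces the factor 2 of
  \<open>interp_const\<close>. The common factor \<open>Z\<close> lets the two contributions add
  up.\<close>

lemma (in sigma_finite_measure) nn_integral_powr_le_levels:
  fixes g :: "'a \<Rightarrow> real"
  assumes [measurable]: "g \<in> borel_measurable M" "A \<in> borel_measurable borel" "B \<in> borel_measurable borel"
    and g0: "\<And>x. 0 \<le> g x" and q: "0 < q"
    and AB: "\<And>l. 0 < l \<Longrightarrow> emeasure M {x \<in> space M. 2 * l < g x} \<le> A l + B l"
    and a: "(\<integral>\<^sup>+ l. ennreal (l powr (q - 1)) * indicator {0<..} l * A l \<partial>lborel) \<le> ennreal (Z * a)"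
    and b: "(\<integral>\<^sup>+ l. ennreal (l powr (q - 1)) * indicator {0<..} l * B l \<partial>lborel) \<le> ennreal (Z * b)"
    and nn: "0 \<le> Z" "0 \<le> a" "0 \<le> b"
  shows "(\<integral>\<^sup>+ x. ennreal (g x powr q) \<partial>M) \<le> ennreal (2 powr q * (q * a + q * b) * Z)"
proof -
  let ?i = "\<lambda>l. ennreal (l powr (q - 1)) * indicator {0<..} l"
  have "(\<integral>\<^sup>+ x. ennreal (g x powr q) \<partial>M) = (\<integral>\<^sup>+ x. ennreal (2 powr q) * ennreal ((g x / 2) powr q) \<partial>M)"
    using g0 by (intro nn_integral_cong) (simp add: ennreal_mult[symmetric] powr_divide)
  also have "\<dots> = ennreal (2 powr q) * (\<integral>\<^sup>+ x. ennreal ((g x / 2) powr q) \<partial>M)"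
    by (rule nn_integral_cmult) measurable
  finally have 1: "(\<integral>\<^sup>+ x. ennreal (g x powr q) \<partial>M) = ennreal (2 powr q) * (\<integral>\<^sup>+ x. ennreal ((g x / 2) powr q) \<partial>M)" .
  have 2: "(\<integral>\<^sup>+ x. ennreal ((g x / 2) powr q) \<partial>M)
    = ennreal q * (\<integral>\<^sup>+ l. ?i l * emeasure M {x \<in> space M. l < g x / 2} \<partial>lborel)"
    using q g0 by (intro nn_integral_powr_layer_cake) auto
  have "(\<integral>\<^sup>+ l. ?i l * emeasure M {x \<in> space M. l < g x / 2} \<partial>lborel)
      \<le> (\<integral>\<^sup>+ l. ?i l * A l + ?i l * B l \<partial>lborel)"
  proof (intro nn_integral_mono)
    fix l :: real
    have "{x \<in> space M. l < g x / 2} = {x \<in> space M. 2 * l < g x}" by auto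
    then have "emeasure M {x \<in> space M. l < g x / 2} \<le> A l + B l" if "0 < l"
      using AB[OF that] by simp
    then show "?i l * emeasure M {x \<in> space M. l < g x / 2} \<le> ?i l * A l + ?i l * B l"
      unfolding distrib_left[symmetric] by (cases "0 < l") (auto intro: mult_left_mono)
  qed
  also have "\<dots> = (\<integral>\<^sup>+ l. ?i l * A l \<partial>lborel) + (\<integral>\<^sup>+ l. ?i l * B l \<partial>lborel)"
    by (rule nn_integral_add) auto
  also have "\<dots> \<le> ennreal (Z * a) + ennreal (Z * b)"
    by (intro add_mono a b)
  also have "\<dots> = ennreal (Z * a + Z * b)"
    using nn by simp
  finally have "ennreal (2 powr q) * (ennreal q * (\<integral>\<^sup>+ l. ?i l * emeasure M {x \<in> space M. l < g x / 2} \<partial>lborel))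
    \<le> ennreal (2 powr q) * (ennreal q * ennreal (Z * a + Z * b))"
    by (intro mult_left_mono) auto
  also have "\<dots> = ennreal (2 powr q * (q * (Z * a + Z * b)))"
    using nn q by (simp add: ennreal_mult)
  also have "2 powr q * (q * (Z * a + Z * b)) = 2 powr q * (q * a + q * b) * Z" by (simp add: algebra_simps)
  finally show ?thesis unfolding 1 2 .
qed


text \<open>Equating the two left sides is linear in \<open>ln c\<close> and has the solution
  \<open>b\<close>, since \<open>q\<close> drops out. The relation for \<open>1 / q\<close> then
  identifies the common value as the \<open>q\<close>-th power of the weighted geometric mean of
  \<open>B0\<close> and \<open>B1\<close>.\<close>

lemma balanced_level_scale:
  fixes B0 B1 Q0 Q1 q t :: real
  assumes B: "0 < B0" "0 < B1" and Q: "0 < Q0" "Q0 < Q1" and q: "0 < q"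
    and rel: "1 / q = (1 - t) / Q0 + t / Q1"
  obtains c where "0 < c"
    "B0 powr Q0 * c powr (q - Q0) = (B0 powr (1 - t) * B1 powr t) powr q"
    "B1 powr Q1 * c powr (q - Q1) = (B0 powr (1 - t) * B1 powr t) powr q"
proof -
  define b where "b = (Q1 * ln B1 - Q0 * ln B0) / (Q1 - Q0)"
  have "1 / q = ((1 - t) * Q1 + t * Q0) / (Q0 * Q1)" using rel Q by (simp add: field_simps)
  then have eq: "Q0 * Q1 = q * ((1 - t) * Q1 + t * Q0)" using Q q by (simp add: field_simps)
  have bd: "b * (Q1 - Q0) = Q1 * ln B1 - Q0 * ln B0" using Q by (simp add: b_def)
  have "(Q1 - Q0) * (Q0 * ln B0 + (q - Q0) * b) = (Q1 - Q0) * (q * ((1 - t) * ln B0 + t * ln B1))"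
    using bd eq by algebra
  then have 1: "Q0 * ln B0 + (q - Q0) * b = q * ((1 - t) * ln B0 + t * ln B1)" using Q by simp
  have "(Q1 - Q0) * (Q1 * ln B1 + (q - Q1) * b) = (Q1 - Q0) * (q * ((1 - t) * ln B0 + t * ln B1))"
    using bd eq by algebra
  then have 2: "Q1 * ln B1 + (q - Q1) * b = q * ((1 - t) * ln B0 + t * ln B1)" using Q by simp
  have Z: "(B0 powr (1 - t) * B1 powr t) powr q = exp (q * ((1 - t) * ln B0 + t * ln B1))"
    using B by (simp add: powr_def exp_add[symmetric])
  show ?thesis
  proof (rule that[of "exp b"])
    show "B0 powr Q0 * exp b powr (q - Q0) = (B0 powr (1 - t) * B1 powr t) powr q"
      unfolding Z 1[symmetric] using B by (simp add: powr_def exp_add)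
    show "B1 powr Q1 * exp b powr (q - Q1) = (B0 powr (1 - t) * B1 powr t) powr q"
      unfolding Z 2[symmetric] using B by (simp add: powr_def exp_add)
  qed simp
qed

section \<open>Seminorms of set-valued functions\<close>

lemma seminorm_on_space_0: "seminorm_on_space s \<Longrightarrow> s 0 = 0"
  unfolding seminorm_on_space_def by (metis abs_zero mult_zero_left scaleR_zero_left)

text \<open>A seminorm is convex, and finite convex functions on a finite-dimensional space are
  continuous.\<close>

lemma continuous_seminorm_on_space:
  assumes "seminorm_on_space s"
  shows "continuous_on UNIV s"
proof (rule convex_on_continuous)
  show "convex_on UNIV s"
  proof (rule convex_onI)
    fix t :: real and x y
    assume t: "0 < t" "t < 1"
    have add: "s (v + w) \<le> s v + s w" and hom: "s (a *\<^sub>R v) = \<bar>a\<bar> * s v" for a v w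
      using assms unfolding seminorm_on_space_def by blast+
    show "s ((1 - t) *\<^sub>R x + t *\<^sub>R y) \<le> (1 - t) * s x + t * s y"
      using add[of "(1 - t) *\<^sub>R x" "t *\<^sub>R y"] t by (simp add: hom)
  qed simp
qed simp

text \<open>The closure of \<open>E\<close> is compact, and the continuous seminorm is bounded on
  it.\<close>

lemma rho_set_less_top:
  assumes "seminorm_on_space (\<rho> x)" "bounded E"
  shows "rho_set \<rho> x E < top"
proof -
  have "compact (\<rho> x ` closure E)"
    using assms continuous_on_subset[OF continuous_seminorm_on_space[OF assms(1)]]
    by (intro compact_continuous_image) (auto simp: compact_closure)
  then obtain K where K: "\<And>v. v \<in> closure E \<Longrightarrow> \<bar>\<rho> x v\<bar> \<le> K"
    using compact_imp_bounded[of "\<rho> x ` closure E"] unfolding bounded_real by auto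
  have "rho_set \<rho> x E \<le> ennreal K"
    unfolding rho_set_def
  proof (intro SUP_least ennreal_leI)
    fix v assume "v \<in> E"
    then show "\<rho> x v \<le> K" using K[of v] closure_subset by fastforce
  qed
  also have "\<dots> < top" by simp
  finally show ?thesis .
qed

lemma measurable_KbcsD:
  assumes "F \<in> measurable_Kbcs M"
  shows "x \<in> space M \<Longrightarrow> F x \<in> Kbcs" "x \<notin> space M \<Longrightarrow> F x = undefined"
    "open U \<Longrightarrow> {x \<in> space M. F x \<inter> U \<noteq> {}} \<in> sets M"
  using assms by (auto simp: measurable_Kbcs_def PiE_iff extensional_def)

text \<open>By continuity of \<open>\<rho> x\<close>, the condition \<open>\<rho> x v > s\<close> for some \<open>v \<in> F x\<close> is witnessed by a
  basic open set \<open>U\<close> meeting \<open>F x\<close> and a rational \<open>s' > s\<close> such that \<open>\<rho> x \<ge> s'\<close> on a countable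
  dense subset of \<open>U\<close>.\<close>

lemma measurable_rho_set:
  fixes F :: "'a \<Rightarrow> (real ^ 'd) set"
  assumes \<rho>: "seminorm_function M \<rho>" and F: "F \<in> measurable_Kbcs M"
  shows "(\<lambda>x. rho_set \<rho> x (F x)) \<in> borel_measurable M"
proof (rule borel_measurableI_greater)
  fix y :: ennreal
  obtain D :: "(real ^ 'd) set" where D: "countable D" "\<And>X. open X \<Longrightarrow> X \<noteq> {} \<Longrightarrow> \<exists>d\<in>D. d \<in> X"
    using countable_dense_setE by blast
  obtain B :: "(real ^ 'd) set set" where B: "countable B" "topological_basis B"
    using ex_countable_basis by blast
  have sn: "seminorm_on_space (\<rho> x)" if "x \<in> space M" for x
    using \<rho> that by (simp add: seminorm_function_def)
  have [measurable]: "(\<lambda>x. \<rho> x v) \<in> borel_measurable M" for v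
    using \<rho> by (simp add: seminorm_function_def)
  show "{x \<in> space M. y < rho_set \<rho> x (F x)} \<in> sets M"
  proof (cases y)
    case top
    then show ?thesis by simp
  next
    case (real s)
    define G where "G U s' = {x \<in> space M. F x \<inter> U \<noteq> {}} \<inter> {x \<in> space M. \<forall>w\<in>D \<inter> U. s' \<le> \<rho> x w}" for U s'
    have G: "G U s' \<in> sets M" if "U \<in> B" for U s'
      unfolding G_def using D(1) F topological_basis_open[OF B(2) that]
      by (intro sets.Int measurable_KbcsD(3) sets.sets_Collect_countable_Ball) (auto intro: countable_subset)
    have "{x \<in> space M. y < rho_set \<rho> x (F x)} = (\<Union>U\<in>B. \<Union>s'\<in>\<rat> \<inter> {s<..}. G U s')"
    proof (intro equalityI subsetI)
      fix x assume "x \<in> {x \<in> space M. y < rho_set \<rho> x (F x)}"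
      then have x: "x \<in> space M" and "y < rho_set \<rho> x (F x)" by auto
      then obtain v where v: "v \<in> F x" "ennreal s < ennreal (\<rho> x v)"
        using real unfolding rho_set_def less_SUP_iff by auto
      then have "s < \<rho> x v" using real by (simp add: ennreal_less_iff)
      then obtain s' where s': "s' \<in> \<rat>" "s < s'" "s' < \<rho> x v" using Rats_dense_in_real by blast
      have "open {w. s' < \<rho> x w}"
        using continuous_seminorm_on_space[OF sn[OF x]] by (intro open_Collect_less) auto
      then obtain U where U: "U \<in> B" "v \<in> U" "U \<subseteq> {w. s' < \<rho> x w}"
        using topological_basisE[OF B(2), of "{w. s' < \<rho> x w}" v] s' by auto
      then have "x \<in> G U s'" using x v by (force simp: G_def)
      then show "x \<in> (\<Union>U\<in>B. \<Union>s'\<in>\<rat> \<inter> {s<..}. G U s')" using U s' by auto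
    next
      fix x assume "x \<in> (\<Union>U\<in>B. \<Union>s'\<in>\<rat> \<inter> {s<..}. G U s')"
      then obtain U s' where U: "U \<in> B" and s': "s < s'" and xG: "x \<in> G U s'" by auto
      then obtain v where x: "x \<in> space M" and v: "v \<in> F x" "v \<in> U"
        and w: "\<And>w. w \<in> D \<Longrightarrow> w \<in> U \<Longrightarrow> s' \<le> \<rho> x w" by (auto simp: G_def)
      have "s' \<le> \<rho> x v"
      \<comment> \<open>Otherwise the open set of points of \<open>U\<close> with seminorm below
        \<open>s'\<close> contains \<open>v\<close>, hence also a point of \<open>D\<close>.\<close>
      proof (rule ccontr)
        assume "\<not> s' \<le> \<rho> x v"
        then have "U \<inter> {w. \<rho> x w < s'} \<noteq> {}" using v by auto
        moreover have "open (U \<inter> {w. \<rho> x w < s'})"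
          using continuous_seminorm_on_space[OF sn[OF x]] topological_basis_open[OF B(2) U]
          by (intro open_Int open_Collect_less) auto
        ultimately obtain d where "d \<in> D" "d \<in> U" "\<rho> x d < s'"
          using D(2)[of "U \<inter> {w. \<rho> x w < s'}"] by auto
        then show False using w by fastforce
      qed
      then have "y < ennreal (\<rho> x v)" using s' real by (simp add: ennreal_less_iff)
      also have "\<dots> \<le> rho_set \<rho> x (F x)"
        unfolding rho_set_def using v by (intro SUP_upper) auto
      finally show "x \<in> {x \<in> space M. y < rho_set \<rho> x (F x)}" using x by simp
    qed
    moreover have "(\<Union>U\<in>B. \<Union>s'\<in>\<rat> \<inter> {s<..}. G U s') \<in> sets M"
      using B(1) G countable_rat by (intro sets.countable_UN' sets.countable_UN'') (auto intro: countable_Int1)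
    ultimately show ?thesis by simp
  qed
qed

lemma rho_set_le_plus:
  assumes "seminorm_on_space (\<rho> x)" "E \<subseteq> E0 + E1"
  shows "rho_set \<rho> x E \<le> rho_set \<rho> x E0 + rho_set \<rho> x E1"
  unfolding rho_set_def[of \<rho> x E]
proof (rule SUP_least)
  fix v assume "v \<in> E"
  then obtain a b where ab: "v = a + b" "a \<in> E0" "b \<in> E1"
    using assms(2) by (auto simp: set_plus_def)
  have "ennreal (\<rho> x v) \<le> ennreal (\<rho> x a) + ennreal (\<rho> x b)"
    using assms(1) ab(1) by (simp add: seminorm_on_space_def ennreal_plus[symmetric] ennreal_leI del: ennreal_plus)
  also have "\<dots> \<le> rho_set \<rho> x E0 + rho_set \<rho> x E1"
    unfolding rho_set_def using ab by (intro add_mono SUP_upper)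
  finally show "ennreal (\<rho> x v) \<le> rho_set \<rho> x E0 + rho_set \<rho> x E1" .
qed

text \<open>The value \<open>{0}\<close> off \<open>A\<close> lies in \<open>Kbcs\<close>, has
  seminorm 0 and is neutral for the Minkowski sum, so restrictions to complementary sets add up to
  \<open>F\<close>.\<close>

definition setfun_restrict :: "'a measure \<Rightarrow> 'a set \<Rightarrow> ('a \<Rightarrow> (real ^ 'd) set) \<Rightarrow> 'a \<Rightarrow> (real ^ 'd) set" where
  "setfun_restrict M A F = (\<lambda>x\<in>space M. if x \<in> A then F x else {0})"

lemma zero_in_Kbcs: "{0} \<in> Kbcs"
  by (simp add: Kbcs_def)

lemma setfun_restrict_measurable:
  fixes F :: "'a \<Rightarrow> (real ^ 'd) set"
  assumes F: "F \<in> measurable_Kbcs M" and A: "A \<in> sets M"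
  shows "setfun_restrict M A F \<in> measurable_Kbcs M"
  unfolding measurable_Kbcs_def
proof (intro CollectI conjI allI impI)
  show "setfun_restrict M A F \<in> space M \<rightarrow>\<^sub>E Kbcs"
    using measurable_KbcsD(1)[OF F] zero_in_Kbcs by (auto simp: setfun_restrict_def)
  fix U :: "(real ^ 'd) set" assume "open U"
  then have "{x \<in> space M. F x \<inter> U \<noteq> {}} \<inter> A \<union> (if 0 \<in> U then space M - A else {}) \<in> sets M"
    using measurable_KbcsD(3)[OF F] A by auto
  also have "{x \<in> space M. F x \<inter> U \<noteq> {}} \<inter> A \<union> (if 0 \<in> U then space M - A else {})
      = {x \<in> space M. setfun_restrict M A F x \<inter> U \<noteq> {}}"
    using sets.sets_into_space[OF A] by (auto simp: setfun_restrict_def)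
  finally show "{x \<in> space M. setfun_restrict M A F x \<inter> U \<noteq> {}} \<in> sets M" .
qed

lemma rho_set_setfun_restrict:
  assumes "seminorm_function M \<rho>" "x \<in> space M"
  shows "rho_set \<rho> x (setfun_restrict M A F x) = rho_set \<rho> x (F x) * indicator A x"
  using assms seminorm_on_space_0[of "\<rho> x"]
  by (auto simp: setfun_restrict_def rho_set_def seminorm_function_def)

lemma setfun_plus_restrict:
  assumes "F \<in> measurable_Kbcs M"
  shows "setfun_plus M (setfun_restrict M A F) (setfun_restrict M (space M - A) F) = F"
  using measurable_KbcsD(2)[OF assms]
  by (auto simp: setfun_plus_def setfun_restrict_def fun_eq_iff set_zero_plus set_zero[symmetric]
      simp del: set_zero)

lemma setfun_plus_commute: "setfun_plus M F G = setfun_plus M G F"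
  by (simp add: setfun_plus_def add.commute)

lemma Lp_sum_space_commute: "Lp_sum_space M \<rho> p0 p1 = Lp_sum_space M \<rho> p1 p0"
  unfolding Lp_sum_space_def using setfun_plus_commute by blast

text \<open>Exchanging the endpoints replaces \<open>t\<close> by \<open>1 - t\<close>; this reduces
  \<open>q1 < q0\<close> to \<open>q0 < q1\<close>.\<close>

lemma interp_const_commute: "interp_const q0 q1 q t C0 C1 = interp_const q1 q0 q (1 - t) C1 C0"
  by (simp add: interp_const_def ac_simps)

section \<open>Norms, weak norms and restrictions\<close>

lemma ennpowr_ennreal: "0 \<le> a \<Longrightarrow> ennpowr (ennreal a) r = ennreal (a powr r)"
  by (simp add: ennpowr_def)

lemma ennpowr_0 [simp]: "ennpowr 0 r = 0"
  by (simp add: ennpowr_def)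

lemma ennpowr_mono: "a \<le> b \<Longrightarrow> 0 \<le> r \<Longrightarrow> ennpowr a r \<le> ennpowr b r"
  by (auto simp: ennpowr_def top_unique less_top intro!: ennreal_leI powr_mono2 enn2real_mono)

lemma ennpowr_ennpowr: "ennpowr (ennpowr a r) s = ennpowr a (r * s)"
  by (simp add: ennpowr_def powr_powr)

lemma ennpowr_1: "ennpowr a 1 = a"
  by (simp add: ennpowr_def less_top)

lemma ennpowr_cmult: "0 < c \<Longrightarrow> ennpowr (ennreal c * a) r = ennreal (c powr r) * ennpowr a r"
  by (cases a) (auto simp: ennpowr_ennreal ennreal_mult[symmetric] powr_mult ennpowr_def ennreal_mult_top)

text \<open>Values in \<open>Kbcs\<close> are bounded, so \<open>rho_set\<close> is finite on them
  and the passage to reals loses nothing.\<close>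

definition rho_real :: "('a \<Rightarrow> real ^ 'd \<Rightarrow> real) \<Rightarrow> ('a \<Rightarrow> (real ^ 'd) set) \<Rightarrow> 'a \<Rightarrow> real" where
  "rho_real \<rho> F x = enn2real (rho_set \<rho> x (F x))"

lemma rho_real_nonneg [simp]: "0 \<le> rho_real \<rho> F x"
  by (simp add: rho_real_def)

lemma rho_set_eq_rho_real:
  assumes "seminorm_function M \<rho>" "F \<in> measurable_Kbcs M" "x \<in> space M"
  shows "rho_set \<rho> x (F x) = ennreal (rho_real \<rho> F x)"
  using assms measurable_KbcsD(1)[OF assms(2,3)] rho_set_less_top[of \<rho> x "F x"]
  by (simp add: rho_real_def seminorm_function_def Kbcs_def)

lemma measurable_rho_real:
  assumes "seminorm_function M \<rho>" "F \<in> measurable_Kbcs M"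
  shows "rho_real \<rho> F \<in> borel_measurable M"
  using measurable_rho_set[OF assms] unfolding rho_real_def[abs_def] by measurable

lemma Lp_norm_ennreal:
  assumes "seminorm_function M \<rho>" "F \<in> measurable_Kbcs M" "0 < p"
  shows "Lp_norm M \<rho> (ennreal p) F = ennpowr (\<integral>\<^sup>+ x. ennreal (rho_real \<rho> F x powr p) \<partial>M) (1 / p)"
proof -
  have "(\<integral>\<^sup>+ x. ennpowr (rho_set \<rho> x (F x)) p \<partial>M) = (\<integral>\<^sup>+ x. ennreal (rho_real \<rho> F x powr p) \<partial>M)"
    using rho_set_eq_rho_real[OF assms(1,2)] by (intro nn_integral_cong) (simp add: ennpowr_ennreal)
  then show ?thesis using assms by (simp add: Lp_norm_def)
qed

lemma Lp_space_ennrealI: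
  assumes "seminorm_function M \<rho>" "F \<in> measurable_Kbcs M" "0 < p"
    "(\<integral>\<^sup>+ x. ennreal (rho_real \<rho> F x powr p) \<partial>M) < top"
  shows "F \<in> Lp_space M \<rho> (ennreal p)"
  using assms by (simp add: Lp_space_def Lp_norm_ennreal ennpowr_def)

lemma Lp_space_topI:
  assumes "seminorm_function M \<rho>" "F \<in> measurable_Kbcs M" "\<And>x. x \<in> space M \<Longrightarrow> rho_real \<rho> F x \<le> a"
  shows "F \<in> Lp_space M \<rho> top" "Lp_norm M \<rho> top F \<le> ennreal a"
proof -
  show "Lp_norm M \<rho> top F \<le> ennreal a"
    using assms rho_set_eq_rho_real[OF assms(1,2)]
    by (auto simp: Lp_norm_def intro!: esssup_I measurable_rho_set AE_I2 ennreal_leI)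
  then show "F \<in> Lp_space M \<rho> top"
    using assms(2) by (auto simp: Lp_space_def intro: le_less_trans)
qed

text \<open>The supremum in the weak norm dominates its term at \<open>l\<close>; raise to the power
  \<open>Q\<close> and divide by \<open>l powr Q\<close>. In the applications \<open>I\<close> is
  the integral of an \<open>s\<close>-th power, so that \<open>ennpowr I (1 / s)\<close> is an
  \<open>L^s\<close> norm.\<close>

lemma weak_Lp_norm_ennreal_level:
  assumes \<rho>: "seminorm_function M \<rho>" and G: "G \<in> measurable_Kbcs M"
    and pos: "0 < Q" "0 < s" "0 < l" "0 < C"
    and le: "weak_Lp_norm M \<rho> (ennreal Q) G \<le> ennreal C * ennpowr I (1 / s)"
  shows "emeasure M {x \<in> space M. l < rho_real \<rho> G x} \<le> ennreal ((C / l) powr Q) * ennpowr I (Q / s)"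
proof -
  let ?m = "emeasure M {x \<in> space M. l < rho_real \<rho> G x}"
  have eq: "{x \<in> space M. rho_set \<rho> x (G x) > ennreal l} = {x \<in> space M. l < rho_real \<rho> G x}"
    using rho_set_eq_rho_real[OF \<rho> G] pos by (auto simp: ennreal_less_iff)
  have "ennreal l * ennpowr ?m (1 / Q) \<le> weak_Lp_norm M \<rho> (ennreal Q) G"
    using pos unfolding weak_Lp_norm_def
    by (auto simp: eq[symmetric] intro!: SUP_upper2[of l])
  also note le
  finally have "ennpowr (ennreal l * ennpowr ?m (1 / Q)) Q \<le> ennpowr (ennreal C * ennpowr I (1 / s)) Q"
    using pos by (intro ennpowr_mono) auto
  then have "ennreal (l powr Q) * ?m \<le> ennreal (C powr Q) * ennpowr I (Q / s)"
    using pos by (simp add: ennpowr_cmult ennpowr_ennpowr ennpowr_1)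
  then have "ennreal (1 / l powr Q) * (ennreal (l powr Q) * ?m)
      \<le> ennreal (1 / l powr Q) * (ennreal (C powr Q) * ennpowr I (Q / s))"
    by (intro mult_left_mono) auto
  then show ?thesis
    using pos by (simp add: mult.assoc[symmetric] ennreal_mult[symmetric] powr_divide)
qed

text \<open>At \<open>top\<close> the weak norm is the essential supremum, which is attained as a
  bound almost everywhere.\<close>

lemma weak_Lp_norm_top_level:
  assumes \<rho>: "seminorm_function M \<rho>" and G: "G \<in> measurable_Kbcs M"
    and le: "weak_Lp_norm M \<rho> top G \<le> ennreal l" and l: "0 < l"
  shows "emeasure M {x \<in> space M. l < rho_real \<rho> G x} = 0"
proof -
  have [measurable]: "rho_real \<rho> G \<in> borel_measurable M" by (rule measurable_rho_real[OF \<rho> G])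
  have "AE x in M. rho_set \<rho> x (G x) \<le> esssup M (\<lambda>x. rho_set \<rho> x (G x))" by (rule esssup_AE)
  then have "AE x in M. \<not> l < rho_real \<rho> G x"
  proof (rule AE_mp, intro AE_I2 impI)
    fix x assume x: "x \<in> space M" and "rho_set \<rho> x (G x) \<le> esssup M (\<lambda>x. rho_set \<rho> x (G x))"
    then have "ennreal (rho_real \<rho> G x) \<le> ennreal l"
      using le rho_set_eq_rho_real[OF \<rho> G x] by (auto simp: weak_Lp_norm_def Lp_norm_def)
    then show "\<not> l < rho_real \<rho> G x" using l by (simp add: ennreal_le_iff)
  qed
  then show ?thesis by (subst (asm) AE_iff_measurable) auto
qed

lemma rho_real_setfun_restrict:
  assumes "seminorm_function M \<rho>" "x \<in> space M"
  shows "rho_real \<rho> (setfun_restrict M A F) x = rho_real \<rho> F x * indicator A x"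
  using rho_set_setfun_restrict[OF assms] by (auto simp: rho_real_def indicator_def)

lemma nn_integral_rho_real_restrict:
  assumes "seminorm_function M \<rho>"
  shows "(\<integral>\<^sup>+ x. ennreal (rho_real \<rho> (setfun_restrict M {x \<in> space M. P x} F) x powr p) \<partial>M)
    = (\<integral>\<^sup>+ x. ennreal (rho_real \<rho> F x powr p) * indicator {x. P x} x \<partial>M)"
  using assms by (intro nn_integral_cong) (auto simp: rho_real_setfun_restrict indicator_def)

text \<open>The restriction of \<open>F\<close> to the empty set is the zero function; it lies in
  \<open>Lp_space M \<rho> p1\<close>, and adding it leaves \<open>F\<close> unchanged.\<close>

lemma Lp_space_subset_Lp_sum_space:
  assumes \<rho>: "seminorm_function M \<rho>" and p: "1 \<le> p0" "1 \<le> p1"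
  shows "Lp_space M \<rho> p0 \<subseteq> Lp_sum_space M \<rho> p0 p1"
proof
  fix F assume F: "F \<in> Lp_space M \<rho> p0"
  then have Fm: "F \<in> measurable_Kbcs M" by (simp add: Lp_space_def)
  let ?Z = "setfun_restrict M {} F"
  have Z: "?Z \<in> measurable_Kbcs M" using Fm by (intro setfun_restrict_measurable) auto
  have Z0: "rho_real \<rho> ?Z x = 0" if "x \<in> space M" for x
    using rho_real_setfun_restrict[OF \<rho> that] by auto
  have "?Z \<in> Lp_space M \<rho> p1"
  proof (cases p1)
    case top
    then show ?thesis using Lp_space_topI(1)[OF \<rho> Z, of 0] Z0 by auto
  next
    case (real s)
    then have "0 < s" using p by (auto simp: less_le)
    moreover have "(\<integral>\<^sup>+ x. ennreal (rho_real \<rho> ?Z x powr s) \<partial>M) = (\<integral>\<^sup>+ x. 0 \<partial>M)"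
      using Z0 by (intro nn_integral_cong) simp
    ultimately show ?thesis using real Z \<rho> by (auto intro!: Lp_space_ennrealI)
  qed
  moreover have "F = setfun_plus M F ?Z"
    using measurable_KbcsD(2)[OF Fm]
    by (auto simp: setfun_plus_def setfun_restrict_def fun_eq_iff set_zero[symmetric] simp del: set_zero)
  ultimately show "F \<in> Lp_sum_space M \<rho> p0 p1" using F unfolding Lp_sum_space_def by blast
qed

text \<open>The seminorm of \<open>T F\<close> is at most the sum of those of \<open>T F0\<close>
  and \<open>T F1\<close>, so it exceeds \<open>2 * l\<close> only where one of these exceeds
  \<open>l\<close>.\<close>

lemma emeasure_sublinear_split_le:
  assumes \<rho>: "seminorm_function M \<rho>" and p: "1 \<le> p0" "1 \<le> p1"
    and T: "sublinear_setop M (Lp_sum_space M \<rho> p0 p1) T"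
    and F: "F = setfun_plus M F0 F1" "F0 \<in> Lp_space M \<rho> p0" "F1 \<in> Lp_space M \<rho> p1"
  shows "T F \<in> measurable_Kbcs M" "T F0 \<in> measurable_Kbcs M" "T F1 \<in> measurable_Kbcs M"
    "emeasure M {x \<in> space M. 2 * l < rho_real \<rho> (T F) x}
      \<le> emeasure M {x \<in> space M. l < rho_real \<rho> (T F0) x} + emeasure M {x \<in> space M. l < rho_real \<rho> (T F1) x}"
proof -
  let ?D = "Lp_sum_space M \<rho> p0 p1"
  have "F \<in> ?D" using F unfolding Lp_sum_space_def by blast
  moreover have D: "F0 \<in> ?D" "F1 \<in> ?D"
    using Lp_space_subset_Lp_sum_space[OF \<rho> p] Lp_space_subset_Lp_sum_space[OF \<rho> p(2,1)] F
      Lp_sum_space_commute[of M \<rho> p0 p1] by auto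
  ultimately show m: "T F \<in> measurable_Kbcs M" "T F0 \<in> measurable_Kbcs M" "T F1 \<in> measurable_Kbcs M"
    using T by (auto simp: sublinear_setop_def)
  note [measurable] = m[THEN measurable_rho_real[OF \<rho>]]
  have le: "rho_real \<rho> (T F) x \<le> rho_real \<rho> (T F0) x + rho_real \<rho> (T F1) x" if x: "x \<in> space M" for x
  proof -
    have "T F x \<subseteq> T F0 x + T F1 x" using T D x unfolding F(1) sublinear_setop_def by blast
    then have "rho_set \<rho> x (T F x) \<le> rho_set \<rho> x (T F0 x) + rho_set \<rho> x (T F1 x)"
      using \<rho> x by (intro rho_set_le_plus) (auto simp: seminorm_function_def)
    then show ?thesis
      using m[THEN rho_set_eq_rho_real[OF \<rho> _ x]] by (simp add: ennreal_plus[symmetric] del: ennreal_plus)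
  qed
  have "emeasure M {x \<in> space M. 2 * l < rho_real \<rho> (T F) x}
    \<le> emeasure M ({x \<in> space M. l < rho_real \<rho> (T F0) x} \<union> {x \<in> space M. l < rho_real \<rho> (T F1) x})"
    using le by (intro emeasure_mono) fastforce+
  also have "\<dots> \<le> emeasure M {x \<in> space M. l < rho_real \<rho> (T F0) x} + emeasure M {x \<in> space M. l < rho_real \<rho> (T F1) x}"
    by (rule emeasure_subadditive) measurable
  finally show "emeasure M {x \<in> space M. 2 * l < rho_real \<rho> (T F) x}
      \<le> emeasure M {x \<in> space M. l < rho_real \<rho> (T F0) x} + emeasure M {x \<in> space M. l < rho_real \<rho> (T F1) x}" .
qed

section \<open>Interpolation\<close>

lemma ennreal_ge_1_cases:
  assumes "1 \<le> (p::ennreal)"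
  obtains "p = top" | s where "p = ennreal s" "1 \<le> s"
  using assms by (cases p) auto

text \<open>In \<open>ennreal\<close>, \<open>1 / 0 = top\<close> and \<open>1 / top = 0\<close>, so
  a positive real reciprocal forces a positive finite exponent.\<close>

lemma ennreal_inverse_eqD:
  assumes "1 / (p::ennreal) = ennreal X" "0 < X"
  obtains P where "p = ennreal P" "0 < P" "1 / P = X"
proof (cases p)
  case top
  then show ?thesis using assms by simp
next
  case (real P)
  then have "P \<noteq> 0" using assms by auto
  then have "0 < P" using real by simp
  moreover from this have "1 / P = X"
    using assms real divide_ennreal[of 1 P] by (simp add: ennreal_inj)
  ultimately show ?thesis using real that by blast
qed

text \<open>Serves both endpoints, the sign of \<open>e\<close> choosing the piece. Membership and
  the norm bound come from \<open>nn_integral_level_truncated_le\<close>; the norm bound is for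
  \<open>q1 = top\<close>, while the third part feeds the weak-type hypothesis into
  \<open>level_term\<close>.\<close>

lemma level_restriction_bound:
  fixes F :: "'a \<Rightarrow> (real ^ 'd) set"
  assumes \<rho>: "seminorm_function M \<rho>" and F: "F \<in> measurable_Kbcs M"
    and pos: "0 < c" "0 < l" "0 < s" "0 < Q" "0 < C" "e \<noteq> 0" and rel: "p - s = k * e * s"
    and N: "(\<integral>\<^sup>+ x. ennreal (rho_real \<rho> F x powr p) \<partial>M) = ennreal N"
  defines "F' \<equiv> setfun_restrict M {x \<in> space M. level_sel (0 < e) l (c * rho_real \<rho> F x powr k)} F"
  shows "F' \<in> Lp_space M \<rho> (ennreal s)"
    and "Lp_norm M \<rho> (ennreal s) F' \<le> ennpowr (ennreal ((l / c) powr (- e * s)) * ennreal N) (1 / s)"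
    and "T F' \<in> measurable_Kbcs M \<Longrightarrow> weak_Lp_norm M \<rho> (ennreal Q) (T F') \<le> ennreal C * Lp_norm M \<rho> (ennreal s) F' \<Longrightarrow>
      emeasure M {x \<in> space M. l < rho_real \<rho> (T F') x}
        \<le> level_term M (rho_real \<rho> F) (\<lambda>x. c * rho_real \<rho> F x powr k) (0 < e) C Q s l"
proof -
  note [measurable] = measurable_rho_real[OF \<rho> F]
  let ?I = "\<integral>\<^sup>+ x. ennreal (rho_real \<rho> F x powr s) * indicator {x. level_sel (0 < e) l (c * rho_real \<rho> F x powr k)} x \<partial>M"
  have F': "F' \<in> measurable_Kbcs M"
    unfolding F'_def by (rule setfun_restrict_measurable[OF F]) measurable
  have I: "(\<integral>\<^sup>+ x. ennreal (rho_real \<rho> F' x powr s) \<partial>M) = ?I"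
    unfolding F'_def by (rule nn_integral_rho_real_restrict[OF \<rho>])
  have I_le: "?I \<le> ennreal ((l / c) powr (- e * s)) * ennreal N"
    unfolding N[symmetric] by (rule nn_integral_level_truncated_le) (use pos rel in auto)
  also have "\<dots> < top" by (simp add: ennreal_mult_less_top)
  finally show "F' \<in> Lp_space M \<rho> (ennreal s)"
    using F' \<rho> pos by (intro Lp_space_ennrealI) (auto simp: I)
  have norm: "Lp_norm M \<rho> (ennreal s) F' = ennpowr ?I (1 / s)"
    using Lp_norm_ennreal[OF \<rho> F' pos(3)] I by simp
  show "Lp_norm M \<rho> (ennreal s) F' \<le> ennpowr (ennreal ((l / c) powr (- e * s)) * ennreal N) (1 / s)"
    unfolding norm using I_le pos by (intro ennpowr_mono) auto
  assume "T F' \<in> measurable_Kbcs M" "weak_Lp_norm M \<rho> (ennreal Q) (T F') \<le> ennreal C * Lp_norm M \<rho> (ennreal s) F'"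
  then show "emeasure M {x \<in> space M. l < rho_real \<rho> (T F') x}
        \<le> level_term M (rho_real \<rho> F) (\<lambda>x. c * rho_real \<rho> F x powr k) (0 < e) C Q s l"
    unfolding norm level_term_def
    by (intro weak_Lp_norm_ennreal_level[OF \<rho>] pos) auto
qed

text \<open>The degenerate case: Jensen's inequality and the scale \<open>c\<close> are set up for
  \<open>0 < N\<close>. Here the seminorm of \<open>F\<close> vanishes almost everywhere, so
  \<open>F\<close> has \<open>L^s\<close> norm 0 and the weak-type bound makes every superlevel set
  of \<open>T F\<close> null.\<close>

lemma (in sigma_finite_measure) Lp_norm_image_eq_0:
  assumes \<rho>: "seminorm_function M \<rho>" and F: "F \<in> measurable_Kbcs M" and T: "T \<in> Lp_space M \<rho> (ennreal s) \<rightarrow> measurable_Kbcs M"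
    and pos: "0 < s" "0 < p" "0 < Q" "0 < q" "0 < C"
    and weak: "\<And>F. F \<in> Lp_space M \<rho> (ennreal s) \<Longrightarrow>
           weak_Lp_norm M \<rho> (ennreal Q) (T F) \<le> ennreal C * Lp_norm M \<rho> (ennreal s) F"
    and 0: "(\<integral>\<^sup>+ x. ennreal (rho_real \<rho> F x powr p) \<partial>M) = 0"
  shows "Lp_norm M \<rho> (ennreal q) (T F) = 0"
proof -
  note [measurable] = measurable_rho_real[OF \<rho> F]
  have "AE x in M. ennreal (rho_real \<rho> F x powr p) = 0"
    using 0 by (subst (asm) nn_integral_0_iff_AE) auto
  then have "AE x in M. ennreal (rho_real \<rho> F x powr s) = 0"
    by eventually_elim (simp add: ennreal_eq_0_iff)
  then have s0: "(\<integral>\<^sup>+ x. ennreal (rho_real \<rho> F x powr s) \<partial>M) = 0"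
    by (subst nn_integral_0_iff_AE) auto
  then have n0: "Lp_norm M \<rho> (ennreal s) F = 0" and FL: "F \<in> Lp_space M \<rho> (ennreal s)"
    using Lp_norm_ennreal[OF \<rho> F pos(1)] Lp_space_ennrealI[OF \<rho> F pos(1)] by simp_all
  have TF: "T F \<in> measurable_Kbcs M" using T FL by blast
  note [measurable] = measurable_rho_real[OF \<rho> TF]
  have "emeasure M {x \<in> space M. l < rho_real \<rho> (T F) x} = 0" if "0 < l" for l
    using weak_Lp_norm_ennreal_level[OF \<rho> TF pos(3,1) that pos(5), of 0] weak[OF FL] n0 by simp
  then have z: "ennreal (l powr (q - 1)) * indicator {0<..} l * emeasure M {x \<in> space M. l < rho_real \<rho> (T F) x} = 0" for l
    by (cases "0 < l") auto
  have "(\<integral>\<^sup>+ x. ennreal (rho_real \<rho> (T F) x powr q) \<partial>M)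
    = ennreal q * (\<integral>\<^sup>+ l. ennreal (l powr (q - 1)) * indicator {0<..} l *
        emeasure M {x \<in> space M. l < rho_real \<rho> (T F) x} \<partial>lborel)"
    using pos by (intro nn_integral_powr_layer_cake) auto
  also have "\<dots> = 0" unfolding z by simp
  finally have "(\<integral>\<^sup>+ x. ennreal (rho_real \<rho> (T F) x powr q) \<partial>M) = 0" .
  then show ?thesis using Lp_norm_ennreal[OF \<rho> TF pos(4)] by simp
qed

text \<open>The \<open>q\<close>-th root turns \<open>2 powr q\<close> into 2 and \<open>K\<close>
  into \<open>K powr (1 / q)\<close>, the shape of \<open>interp_const\<close>.\<close>

lemma Lp_norm_le_of_nn_integral_le:
  assumes \<rho>: "seminorm_function M \<rho>" and F: "F \<in> measurable_Kbcs M" and G: "G \<in> measurable_Kbcs M"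
    and pos: "0 < p" "0 < q" "0 < N" "0 \<le> K" "0 \<le> C"
    and N: "(\<integral>\<^sup>+ x. ennreal (rho_real \<rho> F x powr p) \<partial>M) = ennreal N"
    and le: "(\<integral>\<^sup>+ x. ennreal (rho_real \<rho> G x powr q) \<partial>M)
      \<le> ennreal (2 powr q * K * (C * N powr (1 / p)) powr q)"
  shows "Lp_norm M \<rho> (ennreal q) G \<le> ennreal (2 * K powr (1 / q) * C) * Lp_norm M \<rho> (ennreal p) F"
proof -
  have "Lp_norm M \<rho> (ennreal q) G \<le> ennpowr (ennreal (2 powr q * K * (C * N powr (1 / p)) powr q)) (1 / q)"
    unfolding Lp_norm_ennreal[OF \<rho> G pos(2)] using le pos by (intro ennpowr_mono) auto
  also have "\<dots> = ennreal (2 * K powr (1 / q) * C * N powr (1 / p))"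
    using pos by (simp add: ennpowr_ennreal powr_mult powr_powr mult.assoc)
  also have "\<dots> = ennreal (2 * K powr (1 / q) * C) * Lp_norm M \<rho> (ennreal p) F"
    using pos by (simp add: Lp_norm_ennreal[OF \<rho> F pos(1)] N ennpowr_ennreal ennreal_mult)
  finally show ?thesis .
qed

lemma (in sigma_finite_measure) marcinkiewicz_finite:
  fixes F :: "'a \<Rightarrow> (real ^ 'd) set"
  assumes \<rho>: "seminorm_function M \<rho>"
    and s: "1 \<le> s0" "s0 \<le> Q0" "1 \<le> s1" "s1 \<le> Q1" and Q: "Q0 < Q1"
    and T: "sublinear_setop M (Lp_sum_space M \<rho> (ennreal s0) (ennreal s1)) T"
    and C: "0 < C0" "0 < C1"
    and w0: "\<And>F. F \<in> Lp_space M \<rho> (ennreal s0) \<Longrightarrow>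
           weak_Lp_norm M \<rho> (ennreal Q0) (T F) \<le> ennreal C0 * Lp_norm M \<rho> (ennreal s0) F"
    and w1: "\<And>F. F \<in> Lp_space M \<rho> (ennreal s1) \<Longrightarrow>
           weak_Lp_norm M \<rho> (ennreal Q1) (T F) \<le> ennreal C1 * Lp_norm M \<rho> (ennreal s1) F"
    and t: "0 < t" "t < 1" and P: "0 < P" "0 < q"
    and rel: "1 / P = (1 - t) / s0 + t / s1" "1 / q = (1 - t) / Q0 + t / Q1"
    and F: "F \<in> measurable_Kbcs M" and N: "(\<integral>\<^sup>+ x. ennreal (rho_real \<rho> F x powr P) \<partial>M) = ennreal N" "0 < N"
  shows "T F \<in> measurable_Kbcs M"
    "(\<integral>\<^sup>+ x. ennreal (rho_real \<rho> (T F) x powr q) \<partial>M)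
      \<le> ennreal (2 powr q * (q / \<bar>q - Q0\<bar> + q / \<bar>q - Q1\<bar>) * (C0 powr (1 - t) * C1 powr t * N powr (1 / P)) powr q)"
proof -
  \<comment> \<open>\<open>B0\<close> and \<open>B1\<close> absorb the powers of \<open>N\<close>
    into the weak-type constants: \<open>B0 powr Q0\<close> is the factor
    \<open>C0 powr Q0 * N powr (Q0 / s0)\<close> of \<open>nn_integral_level_term_le\<close>, and
    likewise for \<open>B1\<close>.\<close>
  define B0 where "B0 = C0 * N powr (1 / s0)"
  define B1 where "B1 = C1 * N powr (1 / s1)"
  define f where "f = rho_real \<rho> F"
  \<comment> \<open>These are \<open>q / Q0 - 1\<close> and \<open>q / Q1 - 1\<close>. The
    definition of \<open>k\<close> solves the exponent relation at index 0; index 1 has to be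
    checked.\<close>
  define e0 where "e0 = (q - Q0) / Q0"
  define e1 where "e1 = (q - Q1) / Q1"
  define k where "k = (P / s0 - 1) / e0"
  have Qpos: "0 < Q0" "0 < Q1" using s by auto
  have "1 / q = 1 / Q0 + t * (1 / Q1 - 1 / Q0)" using rel(2) by (simp add: algebra_simps diff_divide_distrib)
  moreover have "1 / Q1 < 1 / Q0" using Q Qpos by (simp add: field_simps)
  ultimately have "1 / q < 1 / Q0" using t by (simp add: mult_pos_neg)
  then have q0: "Q0 < q" using P Qpos by (simp add: field_simps)
  have "1 / q = 1 / Q1 + (1 - t) * (1 / Q0 - 1 / Q1)" using rel(2) by (simp add: algebra_simps diff_divide_distrib)
  then have "1 / Q1 < 1 / q" using t \<open>1 / Q1 < 1 / Q0\<close> by simp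
  then have q1: "q < Q1" using P Qpos by (simp add: field_simps)
  have e: "0 < e0" "e1 < 0" using q0 q1 Qpos by (auto simp: e0_def e1_def field_simps)
  have rel0: "P - s0 = k * e0 * s0" "q - Q0 = e0 * Q0"
  proof -
    have "k * e0 = P / s0 - 1" using e by (simp add: k_def)
    then show "P - s0 = k * e0 * s0" using s by (simp add: left_diff_distrib)
    show "q - Q0 = e0 * Q0" using Qpos by (simp add: e0_def)
  qed
  \<comment> \<open>The pairs \<open>e0\<close>, \<open>e1\<close> and \<open>P / s0 - 1\<close>,
    \<open>P / s1 - 1\<close> both have mean 0 under the weights \<open>1 - t\<close> and
    \<open>t\<close>, hence are proportional; so the same \<open>k\<close> works at index 1.\<close>
  have "(1 - t) * e0 + t * e1 = q * ((1 - t) / Q0 + t / Q1) - 1"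
    using Qpos by (simp add: e0_def e1_def diff_divide_distrib algebra_simps)
  then have te: "(1 - t) * e0 + t * e1 = 0" using P unfolding rel(2)[symmetric] by simp
  have "(1 - t) * (P / s0 - 1) + t * (P / s1 - 1) = P * ((1 - t) / s0 + t / s1) - 1"
    by (simp add: algebra_simps)
  then have tp: "(1 - t) * (P / s0 - 1) + t * (P / s1 - 1) = 0" using P unfolding rel(1)[symmetric] by simp
  have "t * (P / s1 - 1) = t * (k * e1)"
  proof -
    have "P / s0 - 1 = k * e0" using e by (simp add: k_def)
    then have "(1 - t) * (k * e0) + t * (P / s1 - 1) = 0" using tp by simp
    then show ?thesis using te by algebra
  qed
  then have "P / s1 - 1 = k * e1" using t by simp
  then have ke1: "k * e1 = P / s1 - 1" by simp
  have rel1: "P - s1 = k * e1 * s1" "q - Q1 = e1 * Q1"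
    using s Qpos by (simp add: ke1 left_diff_distrib, simp add: e1_def)
  \<comment> \<open>This scale gives both pieces the common factor \<open>Z\<close>.\<close>
  obtain c where c: "0 < c"
    and Z0: "B0 powr Q0 * c powr (q - Q0) = (B0 powr (1 - t) * B1 powr t) powr q"
    and Z1: "B1 powr Q1 * c powr (q - Q1) = (B0 powr (1 - t) * B1 powr t) powr q"
    using balanced_level_scale[of B0 B1 Q0 Q1 q t] C N Q Qpos P rel(2) by (auto simp: B0_def B1_def)
  define Z where "Z = (B0 powr (1 - t) * B1 powr t) powr q"
  have Z: "Z = (C0 powr (1 - t) * C1 powr t * N powr (1 / P)) powr q"
    unfolding Z_def B0_def B1_def rel(1) using C N
    by (simp add: powr_mult powr_powr powr_add ac_simps)
  let ?S = "\<lambda>e l. {x \<in> space M. level_sel (0 < e) l (c * f x powr k)}"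
  let ?L0 = "level_term M f (\<lambda>x. c * f x powr k) (0 < e0) C0 Q0 s0"
  let ?L1 = "level_term M f (\<lambda>x. c * f x powr k) (0 < e1) C1 Q1 s1"
  have fm[measurable]: "f \<in> borel_measurable M" unfolding f_def by (rule measurable_rho_real[OF \<rho> F])
  have dec: "F = setfun_plus M (setfun_restrict M (?S e0 l) F) (setfun_restrict M (?S e1 l) F)" for l
  proof -
    \<comment> \<open>\<open>e0\<close> and \<open>e1\<close> have opposite signs, so the two
      selections are complementary.\<close>
    have "?S e1 l = space M - ?S e0 l" using e by (auto simp: level_sel_def)
    then show ?thesis using setfun_plus_restrict[OF F, of "?S e0 l"] by simp
  qed
  have L0: "setfun_restrict M (?S e0 l) F \<in> Lp_space M \<rho> (ennreal s0)" if "0 < l" for l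
    unfolding f_def by (rule level_restriction_bound(1)[OF \<rho> F c that _ _ C(1) _ rel0(1) N(1)]) (use s Qpos e in auto)
  have L1: "setfun_restrict M (?S e1 l) F \<in> Lp_space M \<rho> (ennreal s1)" if "0 < l" for l
    unfolding f_def by (rule level_restriction_bound(1)[OF \<rho> F c that _ _ C(2) _ rel1(1) N(1)]) (use s Qpos e in auto)
  have one: "1 \<le> ennreal s0" "1 \<le> ennreal s1" using s by auto
  note split = emeasure_sublinear_split_le[OF \<rho> one T dec L0 L1]
  \<comment> \<open>The split at any positive level places \<open>F\<close> in the domain of
    \<open>T\<close>; level 1 is an arbitrary choice.\<close>
  show TF: "T F \<in> measurable_Kbcs M" using split(1)[of 1] by simp
  have lev: "emeasure M {x \<in> space M. 2 * l < rho_real \<rho> (T F) x} \<le> ?L0 l + ?L1 l" if l: "0 < l" for l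
  proof -
    have "emeasure M {x \<in> space M. l < rho_real \<rho> (T (setfun_restrict M (?S e0 l) F)) x} \<le> ?L0 l"
      unfolding f_def
      by (rule level_restriction_bound(3)[OF \<rho> F c l _ _ C(1) _ rel0(1) N(1)])
         (use s Qpos e split(2)[OF l l] w0[OF L0[OF l]] in \<open>simp_all add: f_def\<close>)
    moreover have "emeasure M {x \<in> space M. l < rho_real \<rho> (T (setfun_restrict M (?S e1 l) F)) x} \<le> ?L1 l"
      unfolding f_def
      by (rule level_restriction_bound(3)[OF \<rho> F c l _ _ C(2) _ rel1(1) N(1)])
         (use s Qpos e split(3)[OF l l] w1[OF L1[OF l]] in \<open>simp_all add: f_def\<close>)
    ultimately show ?thesis by (intro order_trans[OF split(4)[OF l l, of l]] add_mono)
  qed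
  have "(\<integral>\<^sup>+ x. ennreal (rho_real \<rho> (T F) x powr q) \<partial>M)
    \<le> ennreal (2 powr q * (q * (1 / \<bar>q - Q0\<bar>) + q * (1 / \<bar>q - Q1\<bar>)) * Z)"
  proof (rule nn_integral_powr_le_levels[OF _ _ _ _ P(2) lev])
    show "(\<integral>\<^sup>+ l. ennreal (l powr (q - 1)) * indicator {0<..} l * ?L0 l \<partial>lborel) \<le> ennreal (Z * (1 / \<bar>q - Q0\<bar>))"
    proof -
      have "Z = C0 powr Q0 * N powr (Q0 / s0) * c powr (q - Q0)"
        unfolding Z_def Z0[symmetric] unfolding B0_def using C N by (simp add: powr_mult powr_powr)
      then show ?thesis
        using nn_integral_level_term_le[OF fm _ c _ s(2) _ C(1) rel0, of N] N s e by (simp add: f_def)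
    qed
    show "(\<integral>\<^sup>+ l. ennreal (l powr (q - 1)) * indicator {0<..} l * ?L1 l \<partial>lborel) \<le> ennreal (Z * (1 / \<bar>q - Q1\<bar>))"
    proof -
      have "Z = C1 powr Q1 * N powr (Q1 / s1) * c powr (q - Q1)"
        unfolding Z_def Z1[symmetric] unfolding B1_def using C N by (simp add: powr_mult powr_powr)
      then show ?thesis
        using nn_integral_level_term_le[OF fm _ c _ s(4) _ C(2) rel1, of N] N s e by (simp add: f_def)
    qed
  qed (auto simp: Z_def intro: measurable_rho_real[OF \<rho> TF])
  then show "(\<integral>\<^sup>+ x. ennreal (rho_real \<rho> (T F) x powr q) \<partial>M)
      \<le> ennreal (2 powr q * (q / \<bar>q - Q0\<bar> + q / \<bar>q - Q1\<bar>) * (C0 powr (1 - t) * C1 powr t * N powr (1 / P)) powr q)"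
    by (simp add: Z)
qed

lemma (in sigma_finite_measure) marcinkiewicz_infinite:
  fixes F :: "'a \<Rightarrow> (real ^ 'd) set"
  assumes \<rho>: "seminorm_function M \<rho>"
    and s: "1 \<le> s0" "s0 \<le> Q0" and p1: "1 \<le> p1"
    and T: "sublinear_setop M (Lp_sum_space M \<rho> (ennreal s0) p1) T"
    and C: "0 < C0" "0 < C1"
    and w0: "\<And>F. F \<in> Lp_space M \<rho> (ennreal s0) \<Longrightarrow>
           weak_Lp_norm M \<rho> (ennreal Q0) (T F) \<le> ennreal C0 * Lp_norm M \<rho> (ennreal s0) F"
    and w1: "\<And>F. F \<in> Lp_space M \<rho> p1 \<Longrightarrow>
           weak_Lp_norm M \<rho> top (T F) \<le> ennreal C1 * Lp_norm M \<rho> p1 F"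
    and t: "0 < t" "t < 1" and P: "0 < P" "0 < q"
    and i: "i = (if p1 = top then 0 else 1 / enn2real p1)"
    and rel: "1 / P = (1 - t) / s0 + t * i" "1 / q = (1 - t) / Q0"
    and F: "F \<in> measurable_Kbcs M" and N: "(\<integral>\<^sup>+ x. ennreal (rho_real \<rho> F x powr P) \<partial>M) = ennreal N" "0 < N"
  shows "T F \<in> measurable_Kbcs M"
    "(\<integral>\<^sup>+ x. ennreal (rho_real \<rho> (T F) x powr q) \<partial>M)
      \<le> ennreal (2 powr q * (q / \<bar>q - Q0\<bar>) * (C0 powr (1 - t) * C1 powr t * N powr (1 / P)) powr q)"
proof -
  define f where "f = rho_real \<rho> F"
  define e0 where "e0 = (q - Q0) / Q0"
  \<comment> \<open>For \<open>q1 = top\<close> the value of \<open>q / q1 - 1\<close> is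
    \<open>-1\<close>, and the exponent relation at index 1 forces this \<open>k\<close>.\<close>
  define k where "k = 1 - P * i"
  \<comment> \<open>Chosen so that \<open>C1\<close> times the \<open>p1\<close> norm of the lower
    piece is at most \<open>l\<close>, at every level \<open>l\<close>.\<close>
  define c where "c = C1 * N powr i"
  have c: "0 < c" using C N by (simp add: c_def)
  have Qpos: "0 < Q0" using s by auto
  \<comment> \<open>Now \<open>e0 = t / (1 - t)\<close>, and the relation at index 0 is derived from
    the one at index 1.\<close>
  have Q0: "Q0 = (1 - t) * q" using rel(2) Qpos P by (simp add: field_simps)
  have te: "(1 - t) * e0 = t" using Qpos t P unfolding e0_def Q0 by (simp add: field_simps)
  then have e: "0 < e0" using t by (metis zero_less_mult_pos diff_gt_0_iff_gt)
  have tp: "(1 - t) * (P / s0 - 1) = t * k"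
  proof -
    have "P * ((1 - t) / s0 + t * i) = 1" unfolding rel(1)[symmetric] using P by simp
    then show ?thesis by (simp add: k_def algebra_simps)
  qed
  have "(1 - t) * (k * e0) = k * ((1 - t) * e0)" by (simp only: mult.left_commute)
  then have "(1 - t) * (P / s0 - 1) = (1 - t) * (k * e0)" unfolding tp te by (simp only: mult.commute)
  then have ke0: "k * e0 = P / s0 - 1" using t by simp
  have rel0: "P - s0 = k * e0 * s0" "q - Q0 = e0 * Q0"
    using s Qpos by (simp add: ke0 left_diff_distrib, simp add: e0_def)
  define Z where "Z = C0 powr Q0 * N powr (Q0 / s0) * c powr (q - Q0)"
  have Z: "Z = (C0 powr (1 - t) * C1 powr t * N powr (1 / P)) powr q"
  proof -
    have "q - Q0 = t * q" unfolding Q0 by (simp add: algebra_simps)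
    then have "Z = C0 powr ((1 - t) * q) * C1 powr (t * q) * N powr (Q0 / s0 + i * (t * q))"
      unfolding Z_def c_def using C N by (simp add: powr_mult powr_powr powr_add Q0)
    also have "Q0 / s0 + i * (t * q) = 1 / P * q" unfolding rel(1) Q0 by (simp add: algebra_simps)
    finally show ?thesis using C N by (simp add: powr_mult powr_powr)
  qed
  let ?S = "\<lambda>e l. {x \<in> space M. level_sel (0 < e) l (c * f x powr k)}"
  let ?L0 = "level_term M f (\<lambda>x. c * f x powr k) (0 < e0) C0 Q0 s0"
  \<comment> \<open>\<open>-1\<close> takes the place of \<open>e1\<close>; its sign selects the
    lower piece.\<close>
  let ?F1 = "\<lambda>l. setfun_restrict M (?S (-1::real) l) F"
  have fm[measurable]: "f \<in> borel_measurable M" unfolding f_def by (rule measurable_rho_real[OF \<rho> F])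
  have dec: "F = setfun_plus M (setfun_restrict M (?S e0 l) F) (?F1 l)" for l
  proof -
    have "?S (-1::real) l = space M - ?S e0 l" using e by (auto simp: level_sel_def)
    then show ?thesis using setfun_plus_restrict[OF F, of "?S e0 l"] by simp
  qed
  have L0: "setfun_restrict M (?S e0 l) F \<in> Lp_space M \<rho> (ennreal s0)" if "0 < l" for l
    unfolding f_def by (rule level_restriction_bound(1)[OF \<rho> F c that _ _ C(1) _ rel0(1) N(1)]) (use s Qpos e in auto)
  have L1: "?F1 l \<in> Lp_space M \<rho> p1" "ennreal C1 * Lp_norm M \<rho> p1 (?F1 l) \<le> ennreal l" if l: "0 < l" for l
  proof -
    have "?F1 l \<in> Lp_space M \<rho> p1 \<and> ennreal C1 * Lp_norm M \<rho> p1 (?F1 l) \<le> ennreal l"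
    proof (cases rule: ennreal_ge_1_cases[OF p1])
      case 1
      \<comment> \<open>Here \<open>i = 0\<close>, so the piece lives where
        \<open>C1 * f x \<le> l\<close> and is bounded by \<open>l / C1\<close>.\<close>
      then have [simp]: "k = 1" "c = C1" using i N by (auto simp: k_def c_def)
      have m: "?F1 l \<in> measurable_Kbcs M" by (rule setfun_restrict_measurable[OF F]) measurable
      have le: "rho_real \<rho> (?F1 l) x \<le> l / C1" if x: "x \<in> space M" for x
        using rho_real_setfun_restrict[OF \<rho> x] C l
        by (auto simp: level_sel_def indicator_def f_def field_simps)
      have "ennreal C1 * Lp_norm M \<rho> top (?F1 l) \<le> ennreal C1 * ennreal (l / C1)"
        by (intro mult_left_mono Lp_space_topI(2)[OF \<rho> m le]) auto
      also have "\<dots> = ennreal l" using C l by (simp add: ennreal_mult[symmetric])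
      finally show ?thesis using Lp_space_topI(1)[OF \<rho> m le] 1 by simp
    next
      case (2 s1)
      then have i1: "i = 1 / s1" using i by simp
      have rel1: "P - s1 = k * (-1) * s1" using 2 by (simp add: k_def i1 algebra_simps)
      note lrb = level_restriction_bound[OF \<rho> F c l, of s1 Q0 C1 "-1" P k N, folded f_def]
      have "ennreal C1 * Lp_norm M \<rho> (ennreal s1) (?F1 l)
        \<le> ennreal C1 * ennpowr (ennreal ((l / c) powr (- (-1) * s1)) * ennreal N) (1 / s1)"
        using lrb(2) 2 Qpos C rel1 N[folded f_def] by (intro mult_left_mono) auto
      also have "\<dots> = ennreal (C1 * ((l / c) * N powr i))"
        using 2 C c l N by (simp add: i1 ennpowr_ennreal ennreal_mult[symmetric] powr_mult powr_powr)
      also have "C1 * ((l / c) * N powr i) = l" using c l N C unfolding c_def by simp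
      finally show ?thesis using lrb(1) 2 Qpos C rel1 N[folded f_def] by simp
    qed
    then show "?F1 l \<in> Lp_space M \<rho> p1" "ennreal C1 * Lp_norm M \<rho> p1 (?F1 l) \<le> ennreal l" by auto
  qed
  have one: "1 \<le> ennreal s0" using s by auto
  note split = emeasure_sublinear_split_le[OF \<rho> one p1 T dec L0 L1(1)]
  show TF: "T F \<in> measurable_Kbcs M" using split(1)[of 1] by simp
  have lev: "emeasure M {x \<in> space M. 2 * l < rho_real \<rho> (T F) x} \<le> ?L0 l + 0" if l: "0 < l" for l
  proof -
    have "emeasure M {x \<in> space M. l < rho_real \<rho> (T (setfun_restrict M (?S e0 l) F)) x} \<le> ?L0 l"
      unfolding f_def
      by (rule level_restriction_bound(3)[OF \<rho> F c l _ _ C(1) _ rel0(1) N(1)])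
         (use s Qpos e split(2)[OF l l] w0[OF L0[OF l]] in \<open>simp_all add: f_def\<close>)
    moreover have "emeasure M {x \<in> space M. l < rho_real \<rho> (T (?F1 l)) x} \<le> 0"
      using weak_Lp_norm_top_level[OF \<rho> split(3)[OF l l] order_trans[OF w1[OF L1(1)[OF l]] L1(2)[OF l]] l] by simp
    ultimately show ?thesis by (intro order_trans[OF split(4)[OF l l, of l]] add_mono)
  qed
  \<comment> \<open>The second contribution is 0, in agreement with the value of
    \<open>exponent_ratio\<close> at \<open>top\<close>.\<close>
  have "(\<integral>\<^sup>+ x. ennreal (rho_real \<rho> (T F) x powr q) \<partial>M)
    \<le> ennreal (2 powr q * (q * (1 / \<bar>q - Q0\<bar>) + q * 0) * Z)"
  proof (rule nn_integral_powr_le_levels[OF _ _ _ _ P(2) lev])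
    show "(\<integral>\<^sup>+ l. ennreal (l powr (q - 1)) * indicator {0<..} l * ?L0 l \<partial>lborel) \<le> ennreal (Z * (1 / \<bar>q - Q0\<bar>))"
      using nn_integral_level_term_le[OF fm _ c _ s(2) _ C(1) rel0, of N] N s e by (simp add: f_def Z_def)
  qed (use c N C in \<open>auto simp: Z_def intro: measurable_rho_real[OF \<rho> TF]\<close>)
  then show "(\<integral>\<^sup>+ x. ennreal (rho_real \<rho> (T F) x powr q) \<partial>M)
      \<le> ennreal (2 powr q * (q / \<bar>q - Q0\<bar>) * (C0 powr (1 - t) * C1 powr t * N powr (1 / P)) powr q)"
    by (simp add: Z)
qed

text \<open>Reduction to real exponents: \<open>q0 < q1\<close> makes \<open>q0\<close> finite,
  hence also \<open>p0\<close>; then \<open>1 / p\<close> and \<open>1 / q\<close> are positive, so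
  \<open>p\<close> and \<open>q\<close> are finite. Only \<open>p1\<close> and \<open>q1\<close> can
  be \<open>top\<close>.\<close>

lemma (in sigma_finite_measure) marcinkiewicz_ordered:
  fixes F :: "'a \<Rightarrow> (real ^ 'd) set" and p0 p1 q0 q1 p q :: ennreal
  assumes \<rho>: "seminorm_function M \<rho>"
    and p: "1 \<le> p0" "p0 \<le> q0" "1 \<le> p1" "p1 \<le> q1" and less: "q0 < q1"
    and T: "sublinear_setop M (Lp_sum_space M \<rho> p0 p1) T"
    and C: "0 < C0" "0 < C1"
    and w0: "\<And>F. F \<in> Lp_space M \<rho> p0 \<Longrightarrow>
           weak_Lp_norm M \<rho> q0 (T F) \<le> ennreal C0 * Lp_norm M \<rho> p0 F"
    and w1: "\<And>F. F \<in> Lp_space M \<rho> p1 \<Longrightarrow>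
           weak_Lp_norm M \<rho> q1 (T F) \<le> ennreal C1 * Lp_norm M \<rho> p1 F"
    and t: "0 < t" "t < 1"
    and rel: "1 / p = ennreal (1 - t) / p0 + ennreal t / p1" "1 / q = ennreal (1 - t) / q0 + ennreal t / q1"
    and F: "F \<in> Lp_space M \<rho> p"
  shows "Lp_norm M \<rho> q (T F) \<le> ennreal (interp_const q0 q1 q t C0 C1) * Lp_norm M \<rho> p F"
proof -
  have q1: "1 \<le> q0" "1 \<le> q1" using p by auto
  obtain Q0 where Q0: "q0 = ennreal Q0" "1 \<le> Q0" using less by (cases rule: ennreal_ge_1_cases[OF q1(1)]) auto
  have "p0 \<noteq> top" using p(2) Q0 by (auto simp: top_unique)
  then obtain s0 where s0: "p0 = ennreal s0" "1 \<le> s0" by (cases rule: ennreal_ge_1_cases[OF p(1)]) auto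
  have s0Q0: "s0 \<le> Q0" using p(2) s0 Q0 by simp
  define i where "i = (if p1 = top then 0 else 1 / enn2real p1)"
  define j where "j = (if q1 = top then 0 else 1 / enn2real q1)"
  have quot: "ennreal t / r = ennreal (t * (if r = top then 0 else 1 / enn2real r))" if "1 \<le> r" for r
    by (cases rule: ennreal_ge_1_cases[OF that]) (use t in \<open>auto simp: divide_ennreal\<close>)
  have ij: "0 \<le> i" "0 \<le> j" by (auto simp: i_def j_def)
  have X: "0 < (1 - t) / s0 + t * i" "0 < (1 - t) / Q0 + t * j"
    using t ij s0 Q0 by (auto intro!: add_pos_nonneg)
  have "1 / p = ennreal ((1 - t) / s0 + t * i)"
    using rel(1) t ij s0 unfolding quot[OF p(3)] by (simp add: divide_ennreal i_def)
  then obtain P where P: "p = ennreal P" "0 < P" "1 / P = (1 - t) / s0 + t * i"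
    using X(1) by (rule ennreal_inverse_eqD)
  have "1 / q = ennreal ((1 - t) / Q0 + t * j)"
    using rel(2) t ij Q0 unfolding quot[OF q1(2)] by (simp add: divide_ennreal j_def)
  then obtain q' where q: "q = ennreal q'" "0 < q'" "1 / q' = (1 - t) / Q0 + t * j"
    using X(2) by (rule ennreal_inverse_eqD)
  have Fm: "F \<in> measurable_Kbcs M" and "Lp_norm M \<rho> p F < top" using F by (auto simp: Lp_space_def)
  then have "(\<integral>\<^sup>+ x. ennreal (rho_real \<rho> F x powr P) \<partial>M) < top"
    unfolding P(1) Lp_norm_ennreal[OF \<rho> Fm P(2)] by (auto simp: ennpowr_def less_top split: if_splits)
  then obtain N where N: "0 \<le> N" "(\<integral>\<^sup>+ x. ennreal (rho_real \<rho> F x powr P) \<partial>M) = ennreal N"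
    by (cases "\<integral>\<^sup>+ x. ennreal (rho_real \<rho> F x powr P) \<partial>M") auto
  show ?thesis
  proof (cases "N = 0")
    case True
    have "T \<in> Lp_space M \<rho> (ennreal s0) \<rightarrow> measurable_Kbcs M"
      using Lp_space_subset_Lp_sum_space[OF \<rho> p(1,3)] T s0 by (auto simp: sublinear_setop_def)
    then have "Lp_norm M \<rho> (ennreal q') (T F) = 0"
      using w0 s0 Q0 N True P q C
      by (intro Lp_norm_image_eq_0[OF \<rho> Fm, where s=s0 and p=P and Q=Q0 and C=C0]) auto
    then show ?thesis by (simp add: q)
  next
    case False
    then have N0: "0 < N" using N by simp
    show ?thesis
    proof (cases rule: ennreal_ge_1_cases[OF q1(2)])
      case 1
      have i2: "1 / q' = (1 - t) / Q0" using q(3) 1 by (simp add: j_def)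
      note mi = marcinkiewicz_infinite[OF \<rho> s0(2) s0Q0 p(3) T[unfolded s0(1)] C w0[unfolded s0(1) Q0(1)]
          w1[unfolded 1] t P(2) q(2) i_def P(3) i2 Fm N(2) N0]
      have "Lp_norm M \<rho> (ennreal q') (T F) \<le> ennreal (2 * (q' / \<bar>q' - Q0\<bar>) powr (1 / q') * (C0 powr (1 - t) * C1 powr t)) * Lp_norm M \<rho> (ennreal P) F"
        using mi(2) q(2) by (intro Lp_norm_le_of_nn_integral_le[OF \<rho> Fm mi(1) P(2) q(2) N0 _ _ N(2)]) auto
      then show ?thesis
        using Q0 q P 1 by (simp add: interp_const_def exponent_ratio_def mult.assoc)
    next
      case (2 Q1)
      have "p1 \<noteq> top" using p(4) 2 by (auto simp: top_unique)
      then obtain s1 where s1: "p1 = ennreal s1" "1 \<le> s1" by (cases rule: ennreal_ge_1_cases[OF p(3)]) auto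
      have s1Q1: "s1 \<le> Q1" using p(4) s1 2 by simp
      have QQ: "Q0 < Q1" using less Q0 2 by (simp add: ennreal_less_iff)
      have r1: "1 / P = (1 - t) / s0 + t / s1" using P(3) s1 by (simp add: i_def)
      have r2: "1 / q' = (1 - t) / Q0 + t / Q1" using q(3) 2 by (simp add: j_def)
      note mf = marcinkiewicz_finite[OF \<rho> s0(2) s0Q0 s1(2) s1Q1 QQ T[unfolded s0(1) s1(1)] C w0[unfolded s0(1) Q0(1)]
          w1[unfolded s1(1) 2(1)] t P(2) q(2) r1 r2 Fm N(2) N0]
      have "Lp_norm M \<rho> (ennreal q') (T F) \<le> ennreal (2 * (q' / \<bar>q' - Q0\<bar> + q' / \<bar>q' - Q1\<bar>) powr (1 / q') * (C0 powr (1 - t) * C1 powr t)) * Lp_norm M \<rho> (ennreal P) F"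
        using mf(2) q(2) by (intro Lp_norm_le_of_nn_integral_le[OF \<rho> Fm mf(1) P(2) q(2) N0 _ _ N(2)]) auto
      then show ?thesis
        using Q0 q P 2 by (simp add: interp_const_def exponent_ratio_def mult.assoc)
    qed
  qed
qed

theorem theorem3p1:
  fixes M :: "(real ^ 'n) measure"
    and \<rho> :: "real ^ 'n \<Rightarrow> real ^ 'd \<Rightarrow> real"
    and T :: "(real ^ 'n \<Rightarrow> (real ^ 'd) set) \<Rightarrow> real ^ 'n \<Rightarrow> (real ^ 'd) set"
    and p0 p1 q0 q1 p q :: ennreal
    and C0 C1 t :: real
  assumes "sigma_finite_measure M" and "complete_measure M"
    and "seminorm_function M \<rho>"
    and "1 \<le> p0" and "p0 \<le> q0" and "1 \<le> p1" and "p1 \<le> q1" and "q0 \<noteq> q1"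
    and "sublinear_setop M (Lp_sum_space M \<rho> p0 p1) T"
    and "0 < C0" and "0 < C1"
    and "\<And>F. F \<in> Lp_space M \<rho> p0 \<Longrightarrow>
           weak_Lp_norm M \<rho> q0 (T F) \<le> ennreal C0 * Lp_norm M \<rho> p0 F"
    and "\<And>F. F \<in> Lp_space M \<rho> p1 \<Longrightarrow>
           weak_Lp_norm M \<rho> q1 (T F) \<le> ennreal C1 * Lp_norm M \<rho> p1 F"
    and "0 < t" and "t < 1"
    and "1 / p = ennreal (1 - t) / p0 + ennreal t / p1"
    and "1 / q = ennreal (1 - t) / q0 + ennreal t / q1"
    and "F \<in> Lp_space M \<rho> p"
  shows "Lp_norm M \<rho> q (T F) \<le> ennreal (interp_const q0 q1 q t C0 C1) * Lp_norm M \<rho> p F"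
proof -
  interpret sigma_finite_measure M by fact
  show ?thesis
  proof (cases "q0 < q1")
    case True
    show ?thesis
      by (rule marcinkiewicz_ordered[OF assms(3-7) True assms(9-18)])
  next
    case False
    then have less: "q1 < q0" using assms(8) by simp
    \<comment> \<open>The endpoints are exchanged, with \<open>1 - t\<close> in place of
      \<open>t\<close>.\<close>
    have rel: "1 / p = ennreal (1 - (1 - t)) / p1 + ennreal (1 - t) / p0"
      "1 / q = ennreal (1 - (1 - t)) / q1 + ennreal (1 - t) / q0"
      using assms(16,17) by (simp_all add: add.commute)
    have t: "0 < 1 - t" "1 - t < 1" using assms by auto
    show ?thesis
      using marcinkiewicz_ordered[OF assms(3,6,7,4,5) less assms(9)[unfolded Lp_sum_space_commute[of M \<rho> p0 p1]]
        assms(11,10,13,12) t rel assms(18)]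
      unfolding interp_const_commute[of q0 q1] .
  qed
qed

end
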